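(* Assume $\mathrm{cof}(\mathcal M)=\omega_1$. Let $D$ be a discrete space of cardinality $|D|\ge\omega_1$ and let $\alpha D$ be its one-point compactification. Then the product $[0,1]\times\alpha D$ contains a closed subspace $X\subseteq[0,1]\times\alpha D$ which has weight $w(X)=\omega_1$, is first countable and hereditarily paracompact, but is not supercompact.
   Context: A topological space $X$ is supercompact if it has a subbase $\mathcal B$ of its topology such that each cover of $X$ by elements of $\mathcal B$ has a subcover consisting of at most two elements. A space is hereditarily paracompact if each of its subspaces is paracompact. For a discrete space $D$, $\alpha D=\{\infty\}\cup D$ (with $\infty\notin D$) is the space in which a set $U$ is open iff $\infty\notin U$ or $\alpha D\setminus U$ is finite. $\mathcal M$ is the ideal of meager subsets of the real line and $\mathrm{cof}(\mathcal M)$ is its cofinality, i.e. the smallest cardinality of a subfamily $\mathcal A\subseteq\mathcal M$ such that every element of $\mathcal M$ is contained in an element of $\mathcal A$. The weight $w(X)$ is the smallest cardinality of a base of the topology of $X$. *)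

theory Defs
  imports "HOL-Analysis.Analysis"
begin

unbundle cardinal_syntax

abbreviation omega1 :: "nat set rel" where
  "omega1 \<equiv> cardSuc natLeq"

(* The smallest cardinality of a member of a (nonempty) family of sets.  As usual for
   cardinals represented as relations, values are to be compared by \<open>=o\<close> and \<open>\<le>o\<close>. *)
definition min_card :: "'a set set \<Rightarrow> 'a rel" where
  "min_card F = |SOME A. A \<in> F \<and> (\<forall>B\<in>F. |A| \<le>o |B| )|"

lemma min_card:
  assumes "F \<noteq> {}"
  shows "\<exists>A\<in>F. min_card F = |A| \<and> (\<forall>B\<in>F. |A| \<le>o |B| )"
proof -
  have "\<exists>r\<in>card_of ` F. \<forall>r'\<in>card_of ` F. r \<le>o r'"
    using assms by (intro exists_minim_Card_order) (auto simp: card_of_Card_order)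
  then have "\<exists>A. A \<in> F \<and> (\<forall>B\<in>F. |A| \<le>o |B| )" by auto
  from someI_ex[OF this] show ?thesis
    unfolding min_card_def by blast
qed

definition nowhere_dense :: "'a::topological_space set \<Rightarrow> bool" where
  "nowhere_dense N \<longleftrightarrow> interior (closure N) = {}"

definition meager :: "'a::topological_space set \<Rightarrow> bool" where
  "meager A \<longleftrightarrow> (\<exists>\<N>. countable \<N> \<and> (\<forall>N\<in>\<N>. nowhere_dense N) \<and> A = \<Union>\<N>)"

definition cofinality :: "'a set set \<Rightarrow> 'a set rel" where
  "cofinality \<I> = min_card {\<A>. \<A> \<subseteq> \<I> \<and> (\<forall>B\<in>\<I>. \<exists>A\<in>\<A>. B \<subseteq> A)}"

definition base_of :: "'a topology \<Rightarrow> 'a set set \<Rightarrow> bool" where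
  "base_of X \<B> \<longleftrightarrow> openin X = arbitrary union_of (\<lambda>U. U \<in> \<B>)"

(* The empty intersection is the whole space. *)
definition subbase_of :: "'a topology \<Rightarrow> 'a set set \<Rightarrow> bool" where
  "subbase_of X \<B> \<longleftrightarrow> (\<forall>U\<in>\<B>. openin X U) \<and>
     openin X = arbitrary union_of (finite intersection_of (\<lambda>U. U \<in> \<B>) relative_to topspace X)"

definition weight :: "'a topology \<Rightarrow> 'a set rel" where
  "weight X = min_card {\<B>. base_of X \<B>}"

definition supercompact_space :: "'a topology \<Rightarrow> bool" where
  "supercompact_space X \<longleftrightarrow>
     (\<exists>\<B>. subbase_of X \<B> \<and>
        (\<forall>\<C>. \<C> \<subseteq> \<B> \<and> \<Union>\<C> = topspace X \<longrightarrow>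
           (\<exists>\<F>. \<F> \<subseteq> \<C> \<and> finite \<F> \<and> card \<F> \<le> 2 \<and> \<Union>\<F> = topspace X)))"

(* Following the usual convention of general topology, paracompact spaces are Hausdorff. *)
definition paracompact_space :: "'a topology \<Rightarrow> bool" where
  "paracompact_space X \<longleftrightarrow> Hausdorff_space X \<and>
     (\<forall>\<U>. (\<forall>U\<in>\<U>. openin X U) \<and> \<Union>\<U> = topspace X \<longrightarrow>
        (\<exists>\<V>. (\<forall>V\<in>\<V>. openin X V) \<and> \<Union>\<V> = topspace X \<and>
             (\<forall>V\<in>\<V>. \<exists>U\<in>\<U>. V \<subseteq> U) \<and> locally_finite_in X \<V>))"

definition hereditarily_paracompact :: "'a topology \<Rightarrow> bool" where
  "hereditarily_paracompact X \<longleftrightarrow>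
     (\<forall>S. S \<subseteq> topspace X \<longrightarrow> paracompact_space (subtopology X S))"

(* The point at infinity is \<open>None\<close>. *)
abbreviation one_point_discrete :: "'a set \<Rightarrow> 'a option topology" where
  "one_point_discrete D \<equiv> Alexandroff_compactification (discrete_topology D)"

lemma openin_one_point_discrete:
  "openin (one_point_discrete D) U \<longleftrightarrow>
     U \<subseteq> insert None (Some ` D) \<and>
     (None \<notin> U \<or> finite (insert None (Some ` D) - U))"
  (is "?L \<longleftrightarrow> ?R")
proof
  assume ?L
  then consider V where "V \<subseteq> D" "U = Some ` V"
    | C where "finite C" "C \<subseteq> D" "U = insert None (Some ` (D - C))"
    by (auto simp: openin_Alexandroff_compactification compactin_discrete_topology)
  then show ?R
  proof cases
    case 2
    then have "insert None (Some ` D) - U \<subseteq> Some ` C" by auto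
    then have "finite (insert None (Some ` D) - U)"
      using 2(1) by (meson finite_imageI finite_subset)
    with 2 show ?thesis by blast
  qed auto
next
  assume R: ?R
  show ?L
  proof (cases "None \<in> U")
    case False
    with R have "U = Some ` {d\<in>D. Some d \<in> U}" by auto
    then show ?thesis
      by (metis (no_types, lifting) mem_Collect_eq openin_Alexandroff_compactification_image_Some
          openin_discrete_topology subsetI)
  next
    case True
    define C where "C = {d\<in>D. Some d \<notin> U}"
    have "Some ` C \<subseteq> insert None (Some ` D) - U" by (auto simp: C_def)
    with R True have "finite (Some ` C)" by (auto intro: finite_subset)
    then have "finite C" by (auto dest: finite_imageD)
    moreover have "U = insert None (Some ` (D - C))"
      using R True by (auto simp: C_def)
    moreover have "C \<subseteq> D" by (auto simp: C_def)
    ultimately show ?thesis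
      unfolding openin_Alexandroff_compactification by (auto simp: compactin_discrete_topology)
  qed
qed

end

theory Submission
  imports Defs
begin

text \<open>
  Since \<open>cof(\<M>) = \<omega>\<^sub>1\<close>, there are points \<open>\<zeta> d\<close> of the open unit interval, indexed by a set
  \<open>D' \<subseteq> D\<close> of size \<open>\<omega>\<^sub>1\<close>, such that every meager set contains \<open>\<zeta> d\<close> for only countably many
  \<open>d\<close>. The space \<open>X\<close> is the closed interval at level \<open>\<infinity>\<close> together with, at level \<open>d \<in> D'\<close>, a
  set \<open>K d = coded (\<zeta> d)\<close> consisting of \<open>\<zeta> d\<close> and points converging to it. The points are read
  off from the binary expansion of \<open>\<zeta> d\<close>, so that a generic real codes a generic such set. Every
  real lies in only countably many \<open>K d\<close>, whence first countability.

  Suppose \<open>X\<close> had a binary closed subbase, without loss of generality closed under intersections.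
  For each \<open>k\<close> choose a finite cover of \<open>X\<close> by members with projection to the interval shorter than
  \<open>\<eta> k\<close>. For all but countably many \<open>d\<close> the slice at level \<open>d\<close> of each of these members is
  contained in its slice at level \<open>\<infinity>\<close>, and \<open>\<zeta> d\<close> is generic for the countably many slices at level
  \<open>\<infinity>\<close>. Write \<open>K d\<close> as a finite union of subbase members \<open>A\<close>; those not containing \<open>\<zeta> d\<close> stay
  away from it. If \<open>S\<close> is a member of a fine cover through \<open>\<zeta> d\<close>, its slice at \<open>\<infinity>\<close> has a
  boundary point \<open>b\<close> near \<open>\<zeta> d\<close>, and by genericity \<open>K d\<close> has a point \<open>v \<notin> S\<close> so close to \<open>b\<close>
  that each \<open>S'\<close> through \<open>v\<close> in a much finer cover contains \<open>b\<close> at level \<open>\<infinity>\<close>, while \<open>K d\<close>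
  has no point of \<open>S\<close> near \<open>b\<close>. Now \<open>S\<close>, \<open>S'\<close> and an \<open>A\<close> containing \<open>\<zeta> d\<close> and \<open>v\<close>
  meet pairwise but have no common point.
\<close>

section \<open>Meager sets of reals\<close>

lemma nowhere_dense_subset:
  assumes "nowhere_dense B" "A \<subseteq> B"
  shows "nowhere_dense A"
  using assms unfolding nowhere_dense_def
  by (metis closure_mono interior_mono subset_empty)

lemma nowhere_dense_imp_meager: "nowhere_dense A \<Longrightarrow> meager A"
  unfolding meager_def by (intro exI[of _ "{A}"]) auto

lemma meager_subset:
  assumes "meager B" "A \<subseteq> B"
  shows "meager A"
proof -
  obtain \<N> where "countable \<N>" "\<forall>N\<in>\<N>. nowhere_dense N" "B = \<Union>\<N>"
    using assms(1) unfolding meager_def by blast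
  then have "countable ((\<inter>) A ` \<N>)" "\<forall>N\<in>(\<inter>) A ` \<N>. nowhere_dense N" "A = \<Union>((\<inter>) A ` \<N>)"
    using assms(2) by (auto intro: nowhere_dense_subset)
  then show ?thesis unfolding meager_def by blast
qed

lemma meager_UN:
  assumes "countable I" "\<And>i. i \<in> I \<Longrightarrow> meager (A i)"
  shows "meager (\<Union>i\<in>I. A i)"
proof -
  have "\<forall>i\<in>I. \<exists>\<N>. countable \<N> \<and> (\<forall>N\<in>\<N>. nowhere_dense N) \<and> A i = \<Union>\<N>"
    using assms(2) unfolding meager_def by blast
  then obtain \<N> where "\<forall>i\<in>I. countable (\<N> i) \<and> (\<forall>N\<in>\<N> i. nowhere_dense N) \<and> A i = \<Union>(\<N> i)"
    by metis
  then show ?thesis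
    unfolding meager_def using assms(1)
    by (intro exI[of _ "\<Union>i\<in>I. \<N> i"]) auto
qed

lemma countable_imp_meager:
  fixes A :: "'a::{t1_space,perfect_space} set"
  assumes "countable A"
  shows "meager A"
proof -
  have "meager (\<Union>x\<in>A. {x})"
    using assms by (intro meager_UN nowhere_dense_imp_meager) (auto simp: nowhere_dense_def)
  then show ?thesis by simp
qed

text \<open>By Baire, the complements of the closures of countably many nowhere dense sets have a
  dense intersection, which therefore meets \<open>U\<close>.\<close>

lemma not_meager_open:
  fixes U :: "'a::{real_normed_vector,heine_borel} set"
  assumes "open U" "U \<noteq> {}"
  shows "\<not> meager U"
proof
  assume "meager U"
  then obtain \<N> where N: "countable \<N>" "\<forall>N\<in>\<N>. nowhere_dense N" "U = \<Union>\<N>"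
    unfolding meager_def by blast
  have "UNIV \<subseteq> closure (\<Inter>((\<lambda>N. - closure N) ` \<N>))"
  proof (rule Baire)
    show "openin (top_of_set UNIV) T \<and> UNIV \<subseteq> closure T" if "T \<in> (\<lambda>N. - closure N) ` \<N>" for T
      using that N(2) by (auto simp: nowhere_dense_def closure_complement)
  qed (use N in auto)
  with assms have "U \<inter> \<Inter>((\<lambda>N. - closure N) ` \<N>) \<noteq> {}"
    by (metis Int_UNIV_right Int_commute open_Int_closure_eq_empty top.extremum_unique)
  then show False using N(3) closure_subset by fastforce
qed

section \<open>Luzin families of reals indexed by \<open>omega1\<close>\<close>

lemma countable_iff_card_of: "countable A \<longleftrightarrow> |A| \<le>o natLeq"
proof -
  have "countable A \<longleftrightarrow> |A| \<le>o |UNIV :: nat set|"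
    unfolding countable_def card_of_ordLeq[symmetric] by auto
  then show ?thesis
    using card_of_nat ordIso_symmetric ordLeq_ordIso_trans by blast
qed

lemma countable_underS_omega1: "countable (underS omega1 i)"
proof (cases "i \<in> Field omega1")
  case True
  have co: "Card_order omega1" by (simp add: cardSuc_Card_order natLeq_Card_order)
  have "|underS omega1 i| <o omega1" using card_of_underS[OF co True] .
  then have "|underS omega1 i| \<le>o natLeq"
    using cardSuc_ordLeq_ordLess[OF natLeq_Card_order card_of_Card_order] by blast
  then show ?thesis
    by (simp add: countable_iff_card_of)
next
  case False
  then have "underS omega1 i = {}" by (auto simp: underS_def Field_def)
  then show ?thesis by simp
qed

text \<open>Luzin's construction: enumerate a cofinal family of meager sets as \<open>f\<close>
  along \<open>omega1\<close> and pick \<open>z i\<close> outside the countably many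
  \<open>f j\<close> with \<open>j\<close> up to and including \<open>i\<close>. If
  \<open>M \<subseteq> f i\<close>, then \<open>z j \<in> M\<close> forces \<open>j\<close> to
  precede \<open>i\<close>, and initial segments of \<open>omega1\<close> are countable.\<close>

lemma Luzin_family:
  assumes "cofinality {A :: real set. meager A} =o omega1"
  shows "\<exists>z :: nat set \<Rightarrow> real. (\<forall>i\<in>Field omega1. z i \<in> {0<..<1}) \<and>
    (\<forall>M. meager M \<longrightarrow> countable {i \<in> Field omega1. z i \<in> M})"
proof -
  have co: "Card_order omega1" by (simp add: cardSuc_Card_order natLeq_Card_order)
  define \<F> where "\<F> = {\<A>. \<A> \<subseteq> {A :: real set. meager A} \<and> (\<forall>B\<in>{A. meager A}. \<exists>A\<in>\<A>. B \<subseteq> A)}"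
  have "{A. meager A} \<in> \<F>" by (auto simp: \<F>_def)
  then have "\<F> \<noteq> {}" by blast
  from min_card[OF this] obtain \<A> where A: "\<A> \<in> \<F>" "cofinality {A :: real set. meager A} = |\<A>|"
    unfolding cofinality_def \<F>_def by blast
  then have "|Field omega1| =o |\<A>|"
    using assms card_of_Field_ordIso[OF co] ordIso_symmetric ordIso_transitive by metis
  then obtain f where f: "bij_betw f (Field omega1) \<A>" using card_of_ordIso by blast
  have "\<exists>x. x \<in> {0<..<1} \<and> x \<notin> (\<Union>j\<in>insert i (underS omega1 i). f j)" if i: "i \<in> Field omega1" for i
  proof -
    have "insert i (underS omega1 i) \<subseteq> Field omega1"
      using i by (auto simp: underS_def Field_def)
    then have "meager (f j)" if "j \<in> insert i (underS omega1 i)" for j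
      using that f A(1) unfolding \<F>_def bij_betw_def by blast
    then have "meager (\<Union>j\<in>insert i (underS omega1 i). f j)"
      by (intro meager_UN) (simp_all add: countable_underS_omega1)
    moreover have "\<not> meager {0<..<1::real}" by (rule not_meager_open) auto
    ultimately have "\<not> {0<..<1} \<subseteq> (\<Union>j\<in>insert i (underS omega1 i). f j)"
      using meager_subset by blast
    then show ?thesis by blast
  qed
  then obtain z where z: "z i \<in> {0<..<1}" "z i \<notin> (\<Union>j\<in>insert i (underS omega1 i). f j)"
    if "i \<in> Field omega1" for i by metis
  show ?thesis
  proof (intro exI[of _ z] conjI allI impI ballI)
    fix M :: "real set" assume "meager M"
    then obtain i where i: "i \<in> Field omega1" "M \<subseteq> f i"
      using A(1) f unfolding \<F>_def bij_betw_def by blast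
    have "j \<in> underS omega1 i" if j: "j \<in> Field omega1" "z j \<in> M" for j
    proof -
      have "i \<notin> insert j (underS omega1 j)" using z(2)[OF j(1)] i j by blast
      moreover have "total_on (Field omega1) omega1"
        using co by (simp add: card_order_on_def well_order_on_def linear_order_on_def)
      ultimately show ?thesis using i j unfolding total_on_def underS_def by blast
    qed
    then have "{i \<in> Field omega1. z i \<in> M} \<subseteq> underS omega1 i" by blast
    then show "countable {i \<in> Field omega1. z i \<in> M}"
      using countable_underS_omega1 countable_subset by blast
  qed (rule z(1))
qed

lemma Luzin_family_on:
  fixes D :: "'a set"
  assumes "cofinality {A :: real set. meager A} =o omega1" and "omega1 \<le>o |D|"
  shows "\<exists>D' (\<zeta> :: 'a \<Rightarrow> real). D' \<subseteq> D \<and> |D'| =o omega1 \<and> (\<forall>d\<in>D'. \<zeta> d \<in> {0<..<1}) \<and>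
    (\<forall>M. meager M \<longrightarrow> countable {d \<in> D'. \<zeta> d \<in> M})"
proof -
  obtain z :: "nat set \<Rightarrow> real" where z: "\<forall>i\<in>Field omega1. z i \<in> {0<..<1}"
    "\<forall>M. meager M \<longrightarrow> countable {i \<in> Field omega1. z i \<in> M}"
    using Luzin_family[OF assms(1)] by blast
  have co: "Card_order omega1" by (simp add: cardSuc_Card_order natLeq_Card_order)
  have "|Field omega1| \<le>o |D|"
    using ordIso_ordLeq_trans[OF card_of_Field_ordIso[OF co] assms(2)] .
  then obtain g where g: "inj_on g (Field omega1)" "g ` Field omega1 \<subseteq> D"
    by (meson card_of_ordLeq)
  define h where "h = the_inv_into (Field omega1) g"
  have h: "h (g i) = i" if "i \<in> Field omega1" for i
    using g that by (simp add: h_def the_inv_into_f_f)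
  have "|Field omega1| =o |g ` Field omega1|"
    using g card_of_ordIso inj_on_imp_bij_betw by blast
  then have "|g ` Field omega1| =o omega1"
    using ordIso_transitive[OF ordIso_symmetric card_of_Field_ordIso[OF co]] by blast
  moreover have "countable {d \<in> g ` Field omega1. (z \<circ> h) d \<in> M}" if "meager M" for M
  proof -
    have "{d \<in> g ` Field omega1. (z \<circ> h) d \<in> M} \<subseteq> g ` {i \<in> Field omega1. z i \<in> M}"
      using h by auto
    then show ?thesis by (rule countable_subset) (use z(2) that in simp)
  qed
  ultimately show ?thesis using g(2) z(1) h by (intro exI[of _ "g ` Field omega1"] exI[of _ "z \<circ> h"]) auto
qed

section \<open>Convergent sequences coded by reals\<close>

text \<open>
  For \<open>0 \<le> z < 1\<close>, the \<open>n\<close>-th binary digit of \<open>z\<close> is 1 and is followed by exactly \<open>a\<close> zeros and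
  a 1. Requiring the digit 1 in front makes the positions inside a block of zeros inactive, so a
  prescribed code can be appended to any finite binary string without producing further codes.
\<close>

definition run :: "nat \<Rightarrow> nat \<Rightarrow> real \<Rightarrow> bool" where
  "run n a z \<longleftrightarrow> odd \<lfloor>2 ^ n * z\<rfloor> \<and> 1 / 2 ^ Suc a \<le> frac (2 ^ n * z) \<and> frac (2 ^ n * z) < 1 / 2 ^ a"

text \<open>
  Every finite list has arbitrarily large codes; a pair \<open>(q, r)\<close> stands for the map \<open>z \<mapsto> q + r z\<close>.
  The code 0 is empty, so that a string of digits 1 adds no points.
\<close>

definition shape_code :: "nat \<Rightarrow> (rat \<times> rat) list" where
  "shape_code a = (if a = 0 then [] else from_nat (snd (prod_decode a)))"

text \<open>
  The slope \<open>r > 0\<close> ensures that a given real belongs to \<open>coded z\<close> for only countably many \<open>z\<close>.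
\<close>

definition coded_at :: "nat \<Rightarrow> real \<Rightarrow> real set" where
  "coded_at n z = {of_rat q + of_rat r * z | q r a. run n a z \<and> (q, r) \<in> set (shape_code a) \<and> 0 < r} \<inter>
     {0..1} \<inter> ball z (1 / Suc n)"

definition coded :: "real \<Rightarrow> real set" where
  "coded z = insert z (\<Union>n. coded_at n z)"

text \<open>The first component of the pair decoded from \<open>a\<close> is ignored by
  \<open>shape_code\<close>, so it can serve as padding that pushes the code beyond
  \<open>m\<close>.\<close>

lemma shape_code_surj: "\<exists>a>m. shape_code a = xs"
  using le_prod_encode_1[of "Suc m" "to_nat xs"]
  by (intro exI[of _ "prod_encode (Suc m, to_nat xs)"]) (auto simp: shape_code_def)

lemma inverse_power_less_cancel: "1 / 2 ^ a < (1 / 2 ^ b :: real) \<Longrightarrow> b < a"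
  by (simp add: field_simps)

lemma run_unique:
  assumes "run n a z" "run n b z"
  shows "a = b"
proof -
  have "1 / 2 ^ Suc a < (1 / 2 ^ b :: real)" "1 / 2 ^ Suc b < (1 / 2 ^ a :: real)"
    using assms by (auto simp: run_def)
  then have "b < Suc a" "a < Suc b" by (blast dest: inverse_power_less_cancel)+
  then show ?thesis by simp
qed

lemma finite_coded_at: "finite (coded_at n z)"
proof (cases "\<exists>a. run n a z")
  case True
  then obtain a where a: "run n a z" by blast
  have "coded_at n z \<subseteq> (\<lambda>(q, r). of_rat q + of_rat r * z) ` set (shape_code a)"
    using run_unique[OF a] by (force simp: coded_at_def)
  then show ?thesis by (rule finite_subset) simp
qed (auto simp: coded_at_def)

text \<open>Position \<open>n\<close> contributes finitely many points, all within
  \<open>1 / Suc n\<close> of \<open>z\<close>, so only finitely many positions reach distance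
  \<open>e\<close>. Hence \<open>z\<close> is the only possible accumulation point of
  \<open>coded z\<close>.\<close>

lemma finite_coded_away:
  assumes "0 < e"
  shows "finite {t \<in> coded z. e \<le> dist t z}"
proof -
  obtain m where m: "inverse (real (Suc m)) < e" using reals_Archimedean[OF assms] by blast
  have "{t \<in> coded z. e \<le> dist t z} \<subseteq> (\<Union>n<m. coded_at n z)"
  proof
    fix t assume t: "t \<in> {t \<in> coded z. e \<le> dist t z}"
    then obtain n where n: "t \<in> coded_at n z" using assms by (auto simp: coded_def)
    then have "e < 1 / Suc n" using t by (auto simp: coded_at_def dist_commute)
    then have "inverse (real (Suc m)) < inverse (real (Suc n))"
      using m by (simp add: inverse_eq_divide)
    then have "n < m" by (simp add: field_simps)
    then show "t \<in> (\<Union>n<m. coded_at n z)" using n by blast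
  qed
  then show ?thesis by (rule finite_subset) (simp add: finite_coded_at)
qed

text \<open>A limit point \<open>x\<close> different from \<open>z\<close> would have infinitely
  many points of \<open>A\<close> within half its distance to \<open>z\<close>; these all stay away
  from \<open>z\<close>, against \<open>finite_coded_away\<close>.\<close>

lemma closed_subset_coded:
  assumes A: "A \<subseteq> coded z" and z: "z \<in> A"
  shows "closed A"
proof (unfold closed_limpt, intro allI impI)
  fix x assume x: "x islimpt A"
  show "x \<in> A"
  proof (rule ccontr)
    assume "x \<notin> A"
    then have e: "0 < dist x z / 2" using z by auto
    have "infinite (A \<inter> ball x (dist x z / 2))"
      using x e islimpt_eq_infinite_ball by blast
    moreover have "dist x z / 2 \<le> dist t z" if "t \<in> ball x (dist x z / 2)" for t
    proof -
      have "dist x t < dist x z / 2" using that by simp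
      then show ?thesis using dist_triangle[of x z t] by linarith
    qed
    then have "A \<inter> ball x (dist x z / 2) \<subseteq> {t \<in> coded z. dist x z / 2 \<le> dist t z}"
      using A by blast
    ultimately show False using finite_coded_away[OF e] finite_subset by blast
  qed
qed

lemma coded_subset: "z \<in> {0..1} \<Longrightarrow> coded z \<subseteq> {0..1}"
  by (auto simp: coded_def coded_at_def)

lemma self_in_coded [simp]: "z \<in> coded z"
  by (simp add: coded_def)

lemma closed_coded: "closed (coded z)"
  by (rule closed_subset_coded[OF order_refl]) simp

text \<open>If \<open>z\<close> lies in \<open>V\<close>, the limit of the sequence is kept; if
  \<open>z\<close> lies outside the closure of \<open>V\<close>, only finitely many points remain.
  The excluded case is a meager condition on \<open>z\<close>, and this is what makes the final
  space hereditarily paracompact.\<close>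

lemma compact_coded_Int:
  assumes "z \<in> {0..1}" "open V" "z \<notin> frontier V"
  shows "compact (coded z \<inter> V)"
proof (cases "z \<in> V")
  case True
  have "closed (coded z \<inter> V)" by (rule closed_subset_coded[of _ z]) (use True in auto)
  moreover have "bounded (coded z \<inter> V)"
    by (rule bounded_subset[OF compact_imp_bounded[OF compact_Icc[of 0 1]]])
      (use coded_subset[OF assms(1)] in blast)
  ultimately show ?thesis by (simp add: compact_eq_bounded_closed)
next
  case False
  then have "z \<in> - closure V" using assms(2,3) by (simp add: frontier_def interior_open)
  then obtain e where e: "0 < e" "ball z e \<subseteq> - closure V" by (meson open_contains_ball open_Compl closed_closure)
  have "coded z \<inter> V \<subseteq> {t \<in> coded z. e \<le> dist t z}"
  proof
    fix t assume t: "t \<in> coded z \<inter> V"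
    then have "t \<notin> ball z e" using e(2) closure_subset[of V] by blast
    then show "t \<in> {t \<in> coded z. e \<le> dist t z}" using t by (simp add: dist_commute)
  qed
  then show ?thesis using finite_coded_away[OF e(1)] finite_subset finite_imp_compact by blast
qed

text \<open>For a fixed rational pair with \<open>r > 0\<close> the map
  \<open>z \<mapsto> q + r z\<close> is injective, so \<open>t\<close> and the pair determine
  \<open>z\<close>. As countable sets of reals are meager, a Luzin family then meets this set in
  only countably many indices.\<close>

lemma countable_coded_fibre: "countable {z. t \<in> coded z}"
proof -
  have "{z. t \<in> coded z} \<subseteq> insert t (range (\<lambda>(q, r). (t - of_rat q) / of_rat r))"
  proof
    fix z assume "z \<in> {z. t \<in> coded z}"
    then consider "t = z" | n where "t \<in> coded_at n z" by (auto simp: coded_def)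
    then show "z \<in> insert t (range (\<lambda>(q, r). (t - of_rat q) / of_rat r))"
    proof cases
      case 2
      then obtain q r :: rat where "t = of_rat q + of_rat r * z" "0 < r"
        by (auto simp: coded_at_def)
      then have "z = (\<lambda>(q, r). (t - of_rat q) / of_rat r) (q, r)" by simp
      then show ?thesis by blast
    qed simp
  qed
  then show ?thesis by (rule countable_subset) simp
qed

section \<open>Reals with prescribed binary digits\<close>

text \<open>After the 1 at position \<open>N\<close>, which is the last digit of \<open>p\<close>,
  such a \<open>z\<close> has exactly \<open>a\<close> zeros followed by at least
  \<open>M + 1\<close> ones. The 1 at position \<open>N\<close> ends every block of zeros begun
  earlier. No run starts at a digit 0, and each position of the block of ones up to
  \<open>N + a + M\<close> is followed by another 1, which gives the code 0.\<close>

lemma run_pattern: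
  fixes p :: int and z :: real
  assumes p: "odd p"
    and z: "p / 2 ^ N + 1 / 2 ^ (N + a) * (1 - 1 / 2 ^ Suc M) < z" "z < p / 2 ^ N + 1 / 2 ^ (N + a)"
  shows "run N a z"
    and "\<And>n c. n < N \<Longrightarrow> run n c z \<Longrightarrow> c < N"
    and "\<And>n c. N < n \<Longrightarrow> n \<le> N + a + M \<Longrightarrow> run n c z \<Longrightarrow> c = 0"
proof -
  define x where "x = 2 ^ N * z - p"
  have zx: "2 ^ N * z = p + x" by (simp add: x_def)
  have x1: "x < 1 / 2 ^ a"
    using z(2) by (simp add: x_def field_simps power_add)
  have x2: "1 / 2 ^ a - 1 / 2 ^ (a + Suc M) < x"
    using z(1) by (simp add: x_def field_simps power_add)
  have "(2::real) ^ Suc a \<le> 2 ^ (a + Suc M)" by (intro power_increasing) auto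
  then have "1 / 2 ^ (a + Suc M) \<le> (1 / 2 ^ Suc a :: real)" by (intro divide_left_mono) auto
  moreover have "1 / 2 ^ a = 1 / 2 ^ Suc a + (1 / 2 ^ Suc a :: real)" by simp
  ultimately have x3: "1 / 2 ^ Suc a < x" using x2 by linarith
  then have x0: "0 < x" by (smt (verit) divide_pos_pos zero_less_power)
  have "1 / 2 ^ a \<le> (1::real)" by simp
  then have x4: "x < 1" using x1 by linarith
  have fl: "\<lfloor>p + x\<rfloor> = p" using x0 x4 by (simp add: floor_eq_iff)
  show "run N a z"
    using p x1 x3 fl unfolding run_def zx by (simp add: frac_def)
  show "c < N" if n: "n < N" and c: "run n c z" for n c
  proof -
    define m where "m = \<lfloor>2 ^ n * z\<rfloor>"
    have eq: "2 ^ (N - n) * (2 ^ n * z) = p + x"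
      using n zx by (simp add: mult.assoc[symmetric] power_add[symmetric])
    have f: "2 ^ (N - n) * frac (2 ^ n * z) = (p - 2 ^ (N - n) * m) + x"
      using eq by (simp add: frac_def m_def algebra_simps)
    have "0 \<le> 2 ^ (N - n) * frac (2 ^ n * z)" by simp
    then have "0 \<le> p - 2 ^ (N - n) * m" using f x4 by linarith
    \<comment> \<open>An odd \<open>p\<close> is no multiple of \<open>2 ^ (N - n)\<close>: its last
      digit is the 1 that ends the block of zeros.\<close>
    moreover have "p \<noteq> 2 ^ (N - n) * m" using p n by auto
    ultimately have "1 \<le> real_of_int (p - 2 ^ (N - n) * m)" by linarith
    then have "1 < 2 ^ (N - n) * frac (2 ^ n * z)" using f x0 by linarith
    also have "\<dots> < 2 ^ (N - n) * (1 / 2 ^ c)"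
      using c by (intro mult_strict_left_mono) (auto simp: run_def)
    finally have "(2::real) ^ c < 2 ^ (N - n)" by (simp add: field_simps)
    then show "c < N" by (auto dest: power_less_imp_less_exp)
  qed
  show "c = 0" if n: "N < n" "n \<le> N + a + M" and c: "run n c z" for n c
  proof (cases "n \<le> N + a")
    case True
    define j where "j = n - N"
    have j: "n = N + j" "0 < j" "j \<le> a" using n True by (auto simp: j_def)
    have eq: "2 ^ n * z = 2 ^ j * p + 2 ^ j * x"
    proof -
      have "2 ^ n * z = 2 ^ j * (2 ^ N * z)" by (simp add: j(1) power_add)
      then show ?thesis by (simp add: zx distrib_left)
    qed
    have "2 ^ j * x < 2 ^ j * (1 / 2 ^ a)" using x1 by (rule mult_strict_left_mono) simp
    also have "\<dots> \<le> 2 ^ a * (1 / 2 ^ a)" using j(3) by (intro mult_right_mono power_increasing) auto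
    finally have "2 ^ j * x < 1" by simp
    moreover have "0 < 2 ^ j * x" using x0 by simp
    ultimately have "\<lfloor>2 ^ n * z\<rfloor> = 2 ^ j * p" unfolding eq by (intro floor_unique) simp_all
    then show ?thesis using c j(2) by (simp add: run_def)
  next
    case False
    define j where "j = n - N - a"
    have j: "n = N + a + j" "0 < j" "j \<le> M" using n False by (auto simp: j_def)
    define y where "y = 2 ^ (a + j) * x"
    have eq: "2 ^ n * z = 2 ^ (a + j) * p + y"
    proof -
      have "2 ^ n * z = 2 ^ (a + j) * (2 ^ N * z)" by (simp add: j(1) power_add)
      then show ?thesis by (simp add: zx distrib_left y_def)
    qed
    have "y < 2 ^ (a + j) * (1 / 2 ^ a)" unfolding y_def using x1 by (rule mult_strict_left_mono) simp
    then have y1: "y < 2 ^ j" by (simp add: power_add)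
    have "(2::real) ^ (a + j) * (1 / 2 ^ (a + Suc M)) \<le> 2 ^ (a + M) * (1 / 2 ^ (a + Suc M))"
      using j(3) by (intro mult_right_mono power_increasing) auto
    also have "\<dots> = 1 / 2" by (simp add: power_add)
    finally have "(2::real) ^ (a + j) * (1 / 2 ^ (a + Suc M)) \<le> 1 / 2" .
    moreover have "2 ^ (a + j) * (1 / 2 ^ a - 1 / 2 ^ (a + Suc M)) < y"
      unfolding y_def using x2 by (rule mult_strict_left_mono) simp
    moreover have "2 ^ (a + j) * (1 / 2 ^ a - 1 / 2 ^ (a + Suc M)) =
        2 ^ j - (2::real) ^ (a + j) * (1 / 2 ^ (a + Suc M))"
      by (simp add: right_diff_distrib power_add)
    ultimately have y2: "2 ^ j - 1 / 2 < y" by linarith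
    have "\<lfloor>2 ^ n * z\<rfloor> = 2 ^ (a + j) * p + 2 ^ j - 1"
      unfolding eq using y1 y2 by (intro floor_unique) simp_all
    then have "frac (2 ^ n * z) > 1 / 2"
      unfolding frac_def using y2 eq by simp
    then have "1 / 2 < (1 / 2 ^ c :: real)" using c unfolding run_def by linarith
    then have "1 / 2 ^ 1 < (1 / 2 ^ c :: real)" by simp
    then show ?thesis using inverse_power_less_cancel by blast
  qed
qed

section \<open>Reals generic for shrinking families of closed sets\<close>

lemma odd_dyadic_between:
  fixes c d :: real
  assumes "c < d"
  obtains N and p :: int where "odd p" "c < p / 2 ^ N" "p / 2 ^ N < d"
proof -
  obtain N where N: "3 / (d - c) < 2 ^ N"
    using real_arch_pow[of 2 "3 / (d - c)"] by auto
  \<comment> \<open>For every real \<open>x\<close>, \<open>2 * \<lfloor>x / 2\<rfloor> + 3\<close>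
    is an odd integer above \<open>x\<close> and at most \<open>x + 3\<close>; the choice of
    \<open>N\<close> makes the scaled interval longer than 3.\<close>
  define p where "p = 2 * \<lfloor>2 ^ N * c / 2\<rfloor> + 3"
  have p: "2 ^ N * c < p" "p \<le> 2 ^ N * c + 3" unfolding p_def by linarith+
  have "3 < 2 ^ N * (d - c)" using N assms by (simp add: field_simps)
  then have "p < 2 ^ N * d" using p by (simp add: algebra_simps)
  with p show ?thesis by (intro that[of p N]) (auto simp: p_def field_simps)
qed

lemma finite_pos_lower_bound:
  fixes F :: "real set"
  assumes "finite F"
  obtains e where "0 < e" "\<And>x. x \<in> F \<Longrightarrow> 0 < x \<Longrightarrow> e \<le> x"
proof (rule that[of "Min (insert 1 {x \<in> F. 0 < x})"])
  show "0 < Min (insert 1 {x \<in> F. 0 < x})" using assms by simp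
  show "Min (insert 1 {x \<in> F. 0 < x}) \<le> x" if "x \<in> F" "0 < x" for x
    using assms that by (intro Min_le) auto
qed

text \<open>The bounds on \<open>q\<close> and \<open>q + r\<close> put \<open>q + r z\<close>
  between \<open>b\<close> and \<open>b + \<delta>\<close> for every \<open>z\<close> in the open
  unit interval. Thus the list can be fixed before the real that is to code it.\<close>

lemma finite_rat_intervals_list:
  assumes "finite B" "0 < (\<delta>::real)"
  obtains xs :: "(rat \<times> rat) list" where
    "\<And>b. b \<in> B \<Longrightarrow> \<exists>(q, r)\<in>set xs. 0 < r \<and> b < of_rat q \<and> of_rat q + of_rat r < b + \<delta>"
    "\<And>q r. (q, r) \<in> set xs \<Longrightarrow> \<exists>b\<in>B. b < of_rat q \<and> of_rat q + of_rat r < b + \<delta>"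
proof -
  obtain r :: rat where r: "0 < (of_rat r :: real)" "of_rat r < \<delta> / 2"
    using of_rat_dense[of 0 "\<delta> / 2"] assms(2) by auto
  have "\<exists>q. b < of_rat q \<and> of_rat q < b + \<delta> / 2" for b
    using of_rat_dense[of b "b + \<delta> / 2"] assms(2) by auto
  then obtain q where q: "b < of_rat (q b)" "of_rat (q b) < b + \<delta> / 2" for b :: real by metis
  obtain xs where xs: "set xs = (\<lambda>b. (q b, r)) ` B"
    using finite_list[of "(\<lambda>b. (q b, r)) ` B"] assms(1) by auto
  have "of_rat (q b) + of_rat r < b + \<delta>" for b using q(2)[of b] r(2) by linarith
  with q(1) r(1) show ?thesis by (intro that[of xs]) (auto simp: xs)
qed

text \<open>
  In the application, \<open>\<T> k\<close> consists of the slices at level \<open>\<infinity>\<close> of a finite cover of mesh \<open>\<eta> k\<close>.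
\<close>

locale shrinking_families =
  fixes \<T> :: "nat \<Rightarrow> real set set" and \<eta> :: "nat \<Rightarrow> real"
  assumes fin: "\<And>k. finite (\<T> k)" and clo: "\<And>k S. S \<in> \<T> k \<Longrightarrow> closed S"
    and diam: "\<And>k S s t. S \<in> \<T> k \<Longrightarrow> s \<in> S \<Longrightarrow> t \<in> S \<Longrightarrow> dist s t < \<eta> k"
    and lim: "\<eta> \<longlonglongrightarrow> 0"
begin

text \<open>The configuration that violates binarity. A member \<open>S\<close> through
  \<open>z\<close> and a member \<open>S'\<close> of the \<open>l\<close>-th family through
  \<open>v\<close> share \<open>b\<close>, but no point of \<open>coded z\<close> lies in both: in
  \<open>S'\<close> its distance to \<open>b\<close> would be below \<open>\<eta> l\<close>, and in
  \<open>S\<close> it is not. A third set whose points all come from \<open>coded z\<close>, and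
  which contains \<open>z\<close> and \<open>v\<close>, therefore meets both without a point common
  to all three.\<close>

definition trapped :: "real \<Rightarrow> real \<Rightarrow> bool" where
  "trapped \<epsilon> z \<longleftrightarrow>
     (\<exists>k. \<forall>S\<in>\<T> k. z \<in> S \<longrightarrow>
        (\<exists>v\<in>coded z. \<exists>b\<in>S. \<exists>l. dist v z < \<epsilon> \<and> (\<forall>S'\<in>\<T> l. v \<in> S' \<longrightarrow> b \<in> S') \<and>
           (\<forall>w\<in>coded z \<inter> S. \<eta> l \<le> dist w b)))"

text \<open>
  The scale is the position \<open>N\<close> of the last digit 1 of a dyadic \<open>z0\<close> and fixes \<open>k\<close>. The point \<open>bd S\<close>
  is the last point of \<open>S\<close> before \<open>z0 + e\<close>, and the list \<open>xs\<close> places one point of \<open>coded z\<close> just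
  to the right of each \<open>bd S\<close>. Since \<open>xs\<close> has arbitrarily large codes \<open>a\<close>, the reals \<open>z\<close> coding it at
  position \<open>N\<close> can be taken as close to \<open>z0\<close> as we like, even though \<open>xs\<close> was chosen after all other
  parameters. A further \<open>M\<close> digits 1 keep the remaining points of \<open>coded z\<close> near \<open>z\<close>.
\<close>

lemma interval_trapped:
  assumes cd: "0 \<le> c" "c < d" "d \<le> 1" and \<epsilon>: "0 < \<epsilon>"
  shows "\<exists>x y. c \<le> x \<and> x < y \<and> y \<le> d \<and> (\<forall>z\<in>{x<..<y}. trapped \<epsilon> z)"
proof -
  obtain N and p :: int where p: "odd p" "c < p / 2 ^ N" "p / 2 ^ N < d"
    using odd_dyadic_between[OF cd(2)] by blast
  define z0 where "z0 = p / 2 ^ N"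
  \<comment> \<open>By \<open>run_pattern\<close>, a run of \<open>z\<close> starting before
    position \<open>N\<close> has a code below \<open>N\<close>. So the points coded there are
    values at \<open>z\<close> of the finitely many maps in \<open>P\<close>; the set
    \<open>P0\<close> holds the values of these maps at \<open>z0\<close>.\<close>
  define P where "P = (\<Union>a<N. set (shape_code a))"
  define P0 where "P0 = (\<lambda>(q, r). of_rat q + of_rat r * z0) ` P"
  have finP: "finite P" "finite P0" by (auto simp: P_def P0_def)
  have z0: "c < z0" "z0 < d" using p by (auto simp: z0_def)
  obtain e0 where e0: "0 < e0" "\<And>x. x \<in> (\<lambda>t. t - z0) ` P0 \<Longrightarrow> 0 < x \<Longrightarrow> e0 \<le> x"
    using finite_pos_lower_bound[of "(\<lambda>t. t - z0) ` P0"] finP(2) by blast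
  \<comment> \<open>The bound \<open>e0\<close> keeps \<open>P0\<close> out of the open interval
    from \<open>z0\<close> to \<open>z0 + e\<close>, where the new points will lie;
    \<open>d - z0\<close> keeps that interval inside the given one; \<open>\<epsilon>\<close> bounds
    the distance of \<open>v\<close> from \<open>z\<close>; \<open>1 / Suc N\<close> is the radius
    allowed at position \<open>N\<close>.\<close>
  define e where "e = min e0 (min (d - z0) (min \<epsilon> (1 / Suc N)))"
  have e: "0 < e" "e \<le> d - z0" "e \<le> \<epsilon>" "e \<le> 1 / Suc N"
    using e0(1) z0 \<epsilon> by (auto simp: e_def)
  have eP: "t \<le> z0 \<or> z0 + e \<le> t" if "t \<in> P0" for t
    using e0(2)[of "t - z0"] that by (force simp: e_def)
  define y where "y = z0 + e"
  have small: "\<exists>k. \<eta> k < x" if "0 < x" for x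
    using order_tendstoD(2)[OF lim that] eventually_sequentially by force
  obtain k where k: "\<eta> k < e" using small e(1) by blast
  define R where "R = {S \<in> \<T> k. z0 \<in> S}"
  \<comment> \<open>As \<open>\<eta> k < e\<close>, a member through \<open>z0\<close> cannot
    contain \<open>y\<close>, so the largest point of its compact part in \<open>{z0..y}\<close> is
    below \<open>y\<close>.\<close>
  have "\<exists>b. b \<in> S \<and> z0 \<le> b \<and> b < y \<and> (\<forall>t\<in>{b<..y}. t \<notin> S)" if S: "S \<in> R" for S
  proof -
    have S': "S \<in> \<T> k" "z0 \<in> S" using S by (auto simp: R_def)
    have yS: "y \<notin> S" using diam[OF S'(1) S'(2), of y] k e(1) by (auto simp: y_def dist_real_def)
    have "compact (S \<inter> {z0..y})" using clo[OF S'(1)] by (simp add: closed_Int_compact)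
    moreover have "z0 \<in> S \<inter> {z0..y}" using S'(2) e(1) by (simp add: y_def)
    ultimately obtain b where b: "b \<in> S \<inter> {z0..y}" "\<And>t. t \<in> S \<inter> {z0..y} \<Longrightarrow> t \<le> b"
      using compact_attains_sup[of "S \<inter> {z0..y}"] by blast
    then show ?thesis using yS
      by (intro exI[of _ b]) (force simp: order.order_iff_strict)
  qed
  then have "\<forall>S\<in>R. \<exists>b. b \<in> S \<and> z0 \<le> b \<and> b < y \<and> (\<forall>t\<in>{b<..y}. t \<notin> S)" by blast
  from bchoice[OF this] obtain bd where
    bd0: "\<forall>S\<in>R. bd S \<in> S \<and> z0 \<le> bd S \<and> bd S < y \<and> (\<forall>t\<in>{bd S<..y}. t \<notin> S)" by blast
  have bd: "bd S \<in> S" "z0 \<le> bd S" "bd S < y" "\<And>t. bd S < t \<Longrightarrow> t \<le> y \<Longrightarrow> t \<notin> S"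
    if "S \<in> R" for S
    using bspec[OF bd0 that] by auto
  \<comment> \<open>A member of \<open>R\<close> with \<open>bd S = z0\<close> has no point between
    \<open>z0\<close> and \<open>y\<close>, and a member missing \<open>z0\<close> has none near
    \<open>z0\<close>. So for \<open>z\<close> slightly to the right of \<open>z0\<close> only the
    members in \<open>R'\<close> can contain \<open>z\<close>.\<close>
  define R' where "R' = {S \<in> R. z0 < bd S}"
  define B where "B = bd ` R'"
  have finR: "finite R" "finite R'" "finite B" using fin by (auto simp: R_def R'_def B_def)
  have B: "z0 < b" "b < y" if "b \<in> B" for b using that bd by (auto simp: B_def R'_def)
  define W where "W = P0 \<union> {z0} \<union> B"
  obtain \<mu>' where \<mu>': "0 < \<mu>'" "\<And>x. x \<in> (\<lambda>(t, b). dist t b) ` (W \<times> B) \<Longrightarrow> 0 < x \<Longrightarrow> \<mu>' \<le> x"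
    using finite_pos_lower_bound[of "(\<lambda>(t, b). dist t b) ` (W \<times> B)"] finP finR
    by (auto simp: W_def)
  \<comment> \<open>One third of the least positive distance from \<open>W\<close> to
    \<open>B\<close>: \<open>z\<close> and the points coded up to position \<open>N\<close> are
    displaced by less than \<open>\<mu>\<close> from points of \<open>W\<close>, which leaves a
    distance above \<open>2 * \<mu>\<close> to \<open>b\<close>, while
    \<open>\<eta> l < \<mu>\<close>.\<close>
  define \<mu> where "\<mu> = \<mu>' / 3"
  have \<mu>: "0 < \<mu>" using \<mu>' by (simp add: \<mu>_def)
  have sep: "3 * \<mu> \<le> dist t b" if "t \<in> W" "b \<in> B" "t \<noteq> b" for t b
    using \<mu>'(2)[of "dist t b"] that by (force simp: \<mu>_def)
  have P0B: "t \<noteq> b" if "t \<in> P0" "b \<in> B" for t b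
    using eP[OF that(1)] B[OF that(2)] by (auto simp: y_def)
  have ev4: "\<forall>\<^sub>F z in at_right z0. z < y"
    using e(1) by (auto simp: y_def eventually_at_right_field intro: exI[of _ y])
  have "\<forall>\<^sub>F z in at_right z0. z \<notin> S" if S: "S \<in> \<T> k - R'" for S
  proof (cases "z0 \<in> S")
    case True
    then have SR: "S \<in> R" using S by (simp add: R_def)
    then have "bd S = z0" using S bd(2)[OF SR] by (simp add: R'_def)
    then have "z \<notin> S" if "z < y" "z0 < z" for z
      using bd(4)[OF SR] that by simp
    then show ?thesis using ev4 eventually_at_right_less[of z0] by (auto elim: eventually_elim2)
  next
    case False
    have "open (- S)" using clo S by auto
    then have "\<forall>\<^sub>F z in nhds z0. z \<in> - S" using False by (intro eventually_nhds_in_open) auto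
    then show ?thesis by (auto simp: eventually_at_filter elim: eventually_mono)
  qed
  then have ev1: "\<forall>\<^sub>F z in at_right z0. \<forall>S\<in>\<T> k - R'. z \<notin> S"
    using fin by (intro eventually_ball_finite) auto
  have "\<forall>\<^sub>F z in at_right z0. dist (of_rat q + of_rat r * z) (of_rat q + of_rat r * z0) < \<mu>" for q r :: rat
    using \<mu> by (intro tendstoD tendsto_intros)
  then have ev2: "\<forall>\<^sub>F z in at_right z0. \<forall>x\<in>P. dist (of_rat (fst x) + of_rat (snd x) * z) (of_rat (fst x) + of_rat (snd x) * z0) < \<mu>"
    using finP by (intro eventually_ball_finite) auto
  have ev3: "\<forall>\<^sub>F z in at_right z0. dist z z0 < \<mu>"
    using \<mu> by (intro tendstoD tendsto_intros)
  have "\<forall>\<^sub>F z in at_right z0. (\<forall>S\<in>\<T> k - R'. z \<notin> S) \<and>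
      (\<forall>x\<in>P. dist (of_rat (fst x) + of_rat (snd x) * z) (of_rat (fst x) + of_rat (snd x) * z0) < \<mu>)
      \<and> dist z z0 < \<mu> \<and> z < y"
    using ev1 ev2 ev3 ev4 by eventually_elim blast
  then obtain \<theta> where \<theta>: "z0 < \<theta>"
    "\<And>z S. z0 < z \<Longrightarrow> z < \<theta> \<Longrightarrow> S \<in> \<T> k \<Longrightarrow> z \<in> S \<Longrightarrow> S \<in> R'"
    "\<And>z q r. z0 < z \<Longrightarrow> z < \<theta> \<Longrightarrow> (q, r) \<in> P \<Longrightarrow> dist (of_rat q + of_rat r * z) (of_rat q + of_rat r * z0) < \<mu>"
    "\<And>z. z0 < z \<Longrightarrow> z < \<theta> \<Longrightarrow> dist z z0 < \<mu>" "\<And>z. z0 < z \<Longrightarrow> z < \<theta> \<Longrightarrow> z < y"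
    unfolding eventually_at_right_field by force
  obtain l where l: "\<eta> l < \<mu>" using small \<mu> by blast
  \<comment> \<open>The finitely many closed members of \<open>\<T> l\<close> that miss
    \<open>b\<close> also miss an interval to the right of \<open>b\<close>. With \<open>v\<close>
    placed in this interval, every member of \<open>\<T> l\<close> through \<open>v\<close> contains
    \<open>b\<close>.\<close>
  have "\<forall>\<^sub>F s in at_right b. s < y \<and> (\<forall>S\<in>\<T> l. b \<notin> S \<longrightarrow> s \<notin> S)" if b: "b \<in> B" for b
  proof -
    have "\<forall>\<^sub>F s in at_right b. s < y"
      using B(2)[OF b] by (auto simp: eventually_at_right_field)
    moreover have "\<forall>\<^sub>F s in at_right b. b \<notin> S \<longrightarrow> s \<notin> S" if S: "S \<in> \<T> l" for S
    proof (cases "b \<in> S")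
      case False
      have "open (- S)" using clo S by auto
      then have "\<forall>\<^sub>F z in nhds b. z \<in> - S" using False by (intro eventually_nhds_in_open) auto
      then show ?thesis by (auto simp: eventually_at_filter elim: eventually_mono)
    qed simp
    then have "\<forall>\<^sub>F s in at_right b. \<forall>S\<in>\<T> l. b \<notin> S \<longrightarrow> s \<notin> S"
      using fin by (intro eventually_ball_finite) auto
    ultimately show ?thesis by eventually_elim blast
  qed
  then have "\<forall>b\<in>B. \<exists>s. b < s \<and> (\<forall>t. b < t \<longrightarrow> t < s \<longrightarrow> t < y \<and> (\<forall>S\<in>\<T> l. b \<notin> S \<longrightarrow> t \<notin> S))"
    by (simp add: eventually_at_right_field)
  from bchoice[OF this] obtain s where s0: "\<forall>b\<in>B. b < s b \<and>
      (\<forall>t. b < t \<longrightarrow> t < s b \<longrightarrow> t < y \<and> (\<forall>S\<in>\<T> l. b \<notin> S \<longrightarrow> t \<notin> S))"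
    by blast
  have s: "b < s b" "\<And>t. b < t \<Longrightarrow> t < s b \<Longrightarrow> t < y"
    "\<And>t S. b < t \<Longrightarrow> t < s b \<Longrightarrow> S \<in> \<T> l \<Longrightarrow> t \<in> S \<Longrightarrow> b \<in> S" if "b \<in> B" for b
    using s0 that by blast+
  obtain \<delta>' where \<delta>': "0 < \<delta>'" "\<And>x. x \<in> (\<lambda>b. s b - b) ` B \<Longrightarrow> 0 < x \<Longrightarrow> \<delta>' \<le> x"
    using finite_pos_lower_bound[of "(\<lambda>b. s b - b) ` B"] finR(3) by blast
  define \<delta> where "\<delta> = min \<delta>' \<mu>"
  have \<delta>: "0 < \<delta>" "\<delta> \<le> \<mu>" using \<delta>'(1) \<mu> by (auto simp: \<delta>_def)
  have \<delta>s: "b + \<delta> \<le> s b" if "b \<in> B" for b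
    using \<delta>'(2)[of "s b - b"] s(1)[OF that] that by (force simp: \<delta>_def)
  obtain xs :: "(rat \<times> rat) list" where xs:
    "\<And>b. b \<in> B \<Longrightarrow> \<exists>(q, r)\<in>set xs. 0 < r \<and> b < of_rat q \<and> of_rat q + of_rat r < b + \<delta>"
    "\<And>q r. (q, r) \<in> set xs \<Longrightarrow> \<exists>b\<in>B. b < of_rat q \<and> of_rat q + of_rat r < b + \<delta>"
    using finite_rat_intervals_list[OF finR(3) \<delta>(1)] by blast
  obtain m where m: "(1 / 2) ^ m < \<theta> - z0"
    using real_arch_pow_inv[of "\<theta> - z0" "1 / 2"] \<theta>(1) by auto
  obtain a where a: "m < a" "shape_code a = xs" using shape_code_surj by blast
  obtain M where M: "inverse (real (Suc M)) < \<mu>" using reals_Archimedean[OF \<mu>] by blast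
  define x1 where "x1 = z0 + 1 / 2 ^ (N + a) * (1 - 1 / 2 ^ Suc M)"
  define y1 where "y1 = z0 + 1 / 2 ^ (N + a)"
  have "1 / 2 ^ Suc M < (1::real)" using one_less_power[of "2::real" "Suc M"] by (simp add: divide_less_eq)
  then have x1: "z0 < x1" by (simp add: x1_def)
  have "1 / 2 ^ (N + a) * (1 - 1 / 2 ^ Suc M) < 1 / 2 ^ (N + a) * (1::real)"
    by (intro mult_strict_left_mono) simp_all
  then have x1y1: "x1 < y1" by (simp add: x1_def y1_def)
  have "1 / 2 ^ (N + a) \<le> (1 / 2 :: real) ^ m"
    unfolding power_one_over[symmetric] using a(1) by (intro power_decreasing) auto
  then have y1: "y1 < \<theta>" using m by (simp add: y1_def)
  have y1d: "y1 \<le> d"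
  proof (rule dense_le_bounded[OF x1y1])
    fix w assume "x1 < w" "w < y1"
    then show "w \<le> d" using \<theta>(5)[of w] x1 y1 e(2) by (simp add: y_def)
  qed
  have "trapped \<epsilon> z" if "z \<in> {x1<..<y1}" for z
  proof -
    have z: "z0 < z" "z < \<theta>" using that x1 y1 by auto
    have "z < y1" using that by simp
    then have z01: "0 < z" "z < 1" using y1d cd z(1) z0(1) by linarith+
    have "p / 2 ^ N + 1 / 2 ^ (N + a) * (1 - 1 / 2 ^ Suc M) < z" "z < p / 2 ^ N + 1 / 2 ^ (N + a)"
      using that by (simp_all add: x1_def y1_def z0_def)
    note pz = run_pattern[OF p(1) this]
    have "\<exists>v\<in>coded z. \<exists>b\<in>S. \<exists>l. dist v z < \<epsilon> \<and> (\<forall>S'\<in>\<T> l. v \<in> S' \<longrightarrow> b \<in> S') \<and>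
        (\<forall>w\<in>coded z \<inter> S. \<eta> l \<le> dist w b)" if S: "S \<in> \<T> k" "z \<in> S" for S
    proof -
      have SR: "S \<in> R'" "S \<in> R" using \<theta>(2)[OF z S] by (auto simp: R'_def)
      define b where "b = bd S"
      have b: "b \<in> B" using SR by (auto simp: B_def b_def)
      have z0W: "z0 \<in> W" by (simp add: W_def)
      have zb: "3 * \<mu> \<le> dist z0 b" using sep[OF z0W b] B(1)[OF b] by auto
      obtain q r where qr: "(q, r) \<in> set xs" "0 < r" "b < of_rat q" "of_rat q + of_rat r < b + \<delta>"
        using xs(1)[OF b] by auto
      define v where "v = of_rat q + of_rat r * z"
      have between: "u < of_rat q' + of_rat r' * z \<and> of_rat q' + of_rat r' * z < u + \<delta>"
        if "u < of_rat q'" "of_rat q' + of_rat r' < u + \<delta>" "0 < r'" for u and q' r' :: rat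
      proof -
        have "0 < (of_rat r' :: real)" using that(3) by simp
        then have "0 < of_rat r' * z" "of_rat r' * z < of_rat r'" using z01 by auto
        then show ?thesis using that by linarith
      qed
      have v: "b < v" "v < b + \<delta>" using between[OF qr(3,4,2)] by (auto simp: v_def)
      then have vs: "v < s b" using \<delta>s[OF b] by linarith
      have vy: "v < y" using s(2)[OF b v(1) vs] .
      have zy: "z < y" using \<theta>(5)[OF z] .
      have dvz: "dist v z < e"
        using vy zy v(1) B(1)[OF b] z(1) by (auto simp: y_def dist_real_def)
      have "v \<in> coded_at N z"
      proof -
        have "v \<in> {0..1}" using v(1) B(1)[OF b] z0 cd vy e(2) by (auto simp: y_def)
        moreover have "v \<in> ball z (1 / Suc N)" using dvz e(4) by (simp add: dist_commute)
        ultimately show ?thesis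
          unfolding coded_at_def using pz(1) qr a(2) v_def by blast
      qed
      then have vc: "v \<in> coded z" by (auto simp: coded_def)
      have "\<eta> l \<le> dist w b" if w: "w \<in> coded z" "w \<in> S" for w
      proof -
        have dz: "dist z z0 < \<mu>" using \<theta>(4)[OF z] .
        have zfar: "2 * \<mu> < dist z b"
          using dz zb dist_triangle[of z0 b z] by (simp add: dist_commute)
        consider "w = z" | n where "w \<in> coded_at n z" using w(1) by (auto simp: coded_def)
        then show ?thesis
        proof cases
          case 1
          then show ?thesis using zfar l \<mu> by simp
        next
          case (2 n)
          then obtain q' r' c' where w': "w = of_rat q' + of_rat r' * z" "run n c' z"
            "(q', r') \<in> set (shape_code c')" "0 < r'" "dist z w < 1 / Suc n"
            by (auto simp: coded_at_def)
          \<comment> \<open>By the position coding \<open>w\<close>: old points lie near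
            \<open>P0\<close>; points from \<open>xs\<close> lie just to the right of some point of
            \<open>B\<close>; the block of zeros and ones codes nothing, since the code 0 is empty;
            points of later positions lie within \<open>\<mu>\<close> of \<open>z\<close>.\<close>
          consider "n < N" | "n = N" | "N < n" "n \<le> N + a + M" | "N + a + M < n" by linarith
          then show ?thesis
          proof cases
            case 1
            then have qP: "(q', r') \<in> P" using pz(2) w'(2,3) by (auto simp: P_def)
            define w0 where "w0 = of_rat q' + of_rat r' * z0"
            have "w0 \<in> P0" using qP by (force simp: P0_def w0_def)
            then have "3 * \<mu> \<le> dist w0 b" using sep[of w0 b] P0B[of w0 b] b by (auto simp: W_def)
            moreover have "dist w w0 < \<mu>" using \<theta>(3)[OF z qP] by (simp add: w'(1) w0_def)
            ultimately show ?thesis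
              using dist_triangle[of w0 b w] l \<mu> by (simp add: dist_commute)
          next
            case 2
            then have "c' = a" using run_unique pz(1) w'(2) by blast
            then have "(q', r') \<in> set xs" using w'(3) a(2) by simp
            then obtain b' where b': "b' \<in> B" "b' < of_rat q'" "of_rat q' + of_rat r' < b' + \<delta>"
              using xs(2) by blast
            have wb: "b' < w" "w < b' + \<delta>" using between[OF b'(2,3) w'(4)] by (auto simp: w'(1))
            \<comment> \<open>A point just to the right of \<open>b = bd S\<close> and below
              \<open>y\<close> is not in \<open>S\<close>, whereas \<open>w\<close> is.\<close>
            have "b' \<noteq> b"
            proof
              assume "b' = b"
              moreover from this have "w < y"
                using s(2)[OF b, of w] wb \<delta>s[OF b] by linarith
              ultimately show False
                using bd(4)[OF SR(2), of w] wb(1) w(2) by (simp add: b_def)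
            qed
            then have "3 * \<mu> \<le> dist b' b" using sep[of b' b] b' b by (auto simp: W_def)
            moreover have "dist w b' < \<mu>" using wb \<delta>(2) by (auto simp: dist_real_def)
            ultimately show ?thesis
              using dist_triangle[of b' b w] l \<mu> by (simp add: dist_commute)
          next
            case 3
            then show ?thesis using pz(3)[OF 3 w'(2)] w'(3) by (simp add: shape_code_def)
          next
            case 4
            then have "1 / Suc n \<le> inverse (real (Suc M))"
              by (simp add: inverse_eq_divide frac_le)
            then have "dist z w < \<mu>" using w'(5) M by linarith
            then show ?thesis using zfar dist_triangle[of z b w] l \<mu> by linarith
          qed
        qed
      qed
      moreover have "\<forall>S'\<in>\<T> l. v \<in> S' \<longrightarrow> b \<in> S'" using s(3)[OF b v(1) vs] by blast
      moreover have "b \<in> S" using bd(1)[OF SR(2)] by (simp add: b_def)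
      moreover have "dist v z < \<epsilon>" using dvz e(3) by linarith
      ultimately show ?thesis using vc by blast
    qed
    then show ?thesis unfolding trapped_def by blast
  qed
  moreover have "c \<le> x1" using x1 z0(1) by linarith
  ultimately show ?thesis using x1y1 y1d by blast
qed

lemma trapped_mono:
  assumes "trapped \<delta> z" "\<delta> \<le> \<epsilon>"
  shows "trapped \<epsilon> z"
proof -
  obtain k where k: "\<forall>S\<in>\<T> k. z \<in> S \<longrightarrow>
      (\<exists>v\<in>coded z. \<exists>b\<in>S. \<exists>l. dist v z < \<delta> \<and> (\<forall>S'\<in>\<T> l. v \<in> S' \<longrightarrow> b \<in> S') \<and>
        (\<forall>w\<in>coded z \<inter> S. \<eta> l \<le> dist w b))"
    using assms(1) unfolding trapped_def ..
  show ?thesis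
    unfolding trapped_def
  proof (intro exI[of _ k] ballI impI)
    fix S assume S: "S \<in> \<T> k" "z \<in> S"
    obtain v b l where "v \<in> coded z" "b \<in> S" "dist v z < \<delta>"
      "\<forall>S'\<in>\<T> l. v \<in> S' \<longrightarrow> b \<in> S'" "\<forall>w\<in>coded z \<inter> S. \<eta> l \<le> dist w b"
      using mp[OF bspec[OF k S(1)] S(2)] by (elim bexE exE conjE)
    moreover from this(3) assms(2) have "dist v z < \<epsilon>" by linarith
    ultimately show "\<exists>v\<in>coded z. \<exists>b\<in>S. \<exists>l. dist v z < \<epsilon> \<and> (\<forall>S'\<in>\<T> l. v \<in> S' \<longrightarrow> b \<in> S') \<and>
        (\<forall>w\<in>coded z \<inter> S. \<eta> l \<le> dist w b)"
      by blast
  qed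
qed

text \<open>For fixed \<open>\<epsilon>\<close> the untrapped reals are nowhere dense, because
  \<open>interval_trapped\<close> finds a trapped open interval inside any given one. By
  monotonicity the countably many values \<open>inverse (Suc n)\<close> of \<open>\<epsilon>\<close>
  suffice.\<close>

lemma meager_untrapped:
  "meager {z \<in> {0<..<1}. \<exists>\<epsilon>>0. \<not> trapped \<epsilon> z}"
proof -
  define U where "U \<epsilon> = {z \<in> {0<..<1}. \<not> trapped \<epsilon> z}" for \<epsilon>
  have "nowhere_dense (U \<epsilon>)" if \<epsilon>: "0 < \<epsilon>" for \<epsilon>
  proof (rule ccontr)
    assume "\<not> nowhere_dense (U \<epsilon>)"
    define V where "V = interior (closure (U \<epsilon>))"
    have V: "open V" "V \<noteq> {}" "V \<subseteq> closure (U \<epsilon>)"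
      using \<open>\<not> nowhere_dense (U \<epsilon>)\<close> by (simp_all add: V_def nowhere_dense_def interior_subset)
    then have "V \<inter> U \<epsilon> \<noteq> {}" using open_Int_closure_eq_empty[OF V(1), of "U \<epsilon>"] by blast
    then obtain t where t: "t \<in> V \<inter> {0<..<1}" by (auto simp: U_def)
    moreover have "open (V \<inter> {0<..<1})" using V(1) by auto
    ultimately obtain r where r: "0 < r" "ball t r \<subseteq> V \<inter> {0<..<1}"
      by (meson open_contains_ball)
    have "{t<..<t + r} \<subseteq> ball t r" by (auto simp: dist_real_def)
    then have sub: "{t<..<t + r} \<subseteq> V \<inter> {0<..<1}" using r(2) by (rule subset_trans)
    have "{t..t + r} \<subseteq> {0..1}"
    proof -
      have "closure {t<..<t + r} \<subseteq> {0..1}" using sub by (intro closure_minimal) auto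
      then show ?thesis using r(1) by simp
    qed
    then have tr: "0 \<le> t" "t < t + r" "t + r \<le> 1" using r(1) by auto
    obtain x y where xy: "t \<le> x" "x < y" "y \<le> t + r"
      "\<forall>z\<in>{x<..<y}. trapped \<epsilon> z"
      using interval_trapped[OF tr \<epsilon>] by blast
    then have "{x<..<y} \<inter> U \<epsilon> = {}" unfolding U_def by blast
    then have "{x<..<y} \<inter> closure (U \<epsilon>) = {}"
      by (simp add: open_Int_closure_eq_empty)
    moreover have "{x<..<y} \<subseteq> {t<..<t + r}" using xy(1,3) by auto
    then have "{x<..<y} \<subseteq> closure (U \<epsilon>)" using sub V(3) by blast
    moreover have "{x<..<y} \<noteq> {}" using xy(2) by simp
    ultimately show False by blast
  qed
  then have "meager (U (inverse (real (Suc n))))" for n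
    by (intro nowhere_dense_imp_meager) simp
  then have "meager (\<Union>n. U (inverse (real (Suc n))))"
    by (intro meager_UN) auto
  moreover have "{z \<in> {0<..<1}. \<exists>\<epsilon>>0. \<not> trapped \<epsilon> z} \<subseteq> (\<Union>n. U (inverse (real (Suc n))))"
  proof
    fix z assume "z \<in> {z \<in> {0<..<1}. \<exists>\<epsilon>>0. \<not> trapped \<epsilon> z}"
    then obtain \<epsilon> where z: "z \<in> {0<..<1}" "0 < \<epsilon>" "\<not> trapped \<epsilon> z" by auto
    obtain n where n: "inverse (real (Suc n)) < \<epsilon>" using reals_Archimedean[OF z(2)] by blast
    have "\<not> trapped (inverse (real (Suc n))) z"
    proof
      assume "trapped (inverse (real (Suc n))) z"
      then show False using trapped_mono[OF _ less_imp_le[OF n]] z(3) by simp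
    qed
    then have "z \<in> U (inverse (real (Suc n)))" using z(1) unfolding U_def by simp
    then show "z \<in> (\<Union>n. U (inverse (real (Suc n))))" by blast
  qed
  ultimately show ?thesis by (rule meager_subset)
qed

end

section \<open>The product of the interval with a one-point compactification\<close>

abbreviation unit_times_discrete :: "'a set \<Rightarrow> (real \<times> 'a option) topology" where
  "unit_times_discrete D \<equiv> prod_topology (top_of_set {0..1}) (one_point_discrete D)"

lemma openin_cylinder:
  assumes "Y \<subseteq> topspace (unit_times_discrete D)" "open G" "finite F"
  shows "openin (subtopology (unit_times_discrete D) Y) (Y \<inter> G \<times> (- Some ` F))"
proof -
  have "openin (unit_times_discrete D) (({0..1} \<inter> G) \<times> (insert None (Some ` D) - Some ` F))"
  proof (rule openin_prod_Times_iff[THEN iffD2], intro disjI2 conjI)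
    show "openin (top_of_set {0..1}) ({0..1} \<inter> G)" using assms(2) by blast
    show "openin (one_point_discrete D) (insert None (Some ` D) - Some ` F)"
      unfolding openin_one_point_discrete using assms(3) by (auto simp: Diff_Diff_Int)
  qed
  moreover have "Y \<inter> G \<times> (- Some ` F) = ({0..1} \<inter> G) \<times> (insert None (Some ` D) - Some ` F) \<inter> Y"
    using assms(1) by auto
  ultimately show ?thesis unfolding openin_subtopology by blast
qed

lemma openin_slice:
  assumes "Y \<subseteq> topspace (unit_times_discrete D)" "open G"
  shows "openin (subtopology (unit_times_discrete D) Y) (Y \<inter> G \<times> {Some d})"
proof (cases "d \<in> D")
  case True
  have "openin (unit_times_discrete D) (({0..1} \<inter> G) \<times> {Some d})"
  proof (rule openin_prod_Times_iff[THEN iffD2], intro disjI2 conjI)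
    show "openin (top_of_set {0..1}) ({0..1} \<inter> G)" using assms(2) by blast
    show "openin (one_point_discrete D) {Some d}"
      unfolding openin_one_point_discrete using True by auto
  qed
  moreover have "Y \<inter> G \<times> {Some d} = ({0..1} \<inter> G) \<times> {Some d} \<inter> Y"
    using assms(1) by auto
  ultimately show ?thesis unfolding openin_subtopology by blast
next
  case False
  then have "Y \<inter> G \<times> {Some d} = {}" using assms(1) by auto
  then show ?thesis by simp
qed

text \<open>A basic neighbourhood of a point at level \<infinity> is a cylinder omitting finitely
  many levels, while each level \<open>d\<close> is open and carries the topology of the reals. This
  turns openness into a statement about open sets of reals and finite sets of levels.\<close>

lemma openin_unit_times_discrete:
  assumes Y: "Y \<subseteq> topspace (unit_times_discrete D)"
  shows "openin (subtopology (unit_times_discrete D) Y) U \<longleftrightarrow> U \<subseteq> Y \<and>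
    (\<forall>t. (t, None) \<in> U \<longrightarrow> (\<exists>G F. open G \<and> t \<in> G \<and> finite F \<and> Y \<inter> G \<times> (- Some ` F) \<subseteq> U)) \<and>
    (\<forall>t d. (t, Some d) \<in> U \<longrightarrow> (\<exists>G. open G \<and> t \<in> G \<and> Y \<inter> G \<times> {Some d} \<subseteq> U))"
    (is "?L \<longleftrightarrow> ?R")
proof
  assume ?L
  then obtain W where W: "openin (unit_times_discrete D) W" "U = W \<inter> Y"
    unfolding openin_subtopology by blast
  have nbhd: "\<exists>G V. open G \<and> openin (one_point_discrete D) V \<and> t \<in> G \<and> u \<in> V \<and> ({0..1} \<inter> G) \<times> V \<subseteq> W"
    if "(t, u) \<in> U" for t u
  proof -
    have "(t, u) \<in> W" using that W(2) by blast
    then obtain A V where AV: "openin (top_of_set {0..1}) A" "openin (one_point_discrete D) V"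
      "t \<in> A" "u \<in> V" "A \<times> V \<subseteq> W"
      using W(1)[unfolded openin_prod_topology_alt] by meson
    obtain G where "open G" "A = {0..1} \<inter> G" using AV(1) by (auto simp: openin_open)
    with AV show ?thesis by (intro exI[of _ G] exI[of _ V]) simp
  qed
  show ?R
  proof (intro conjI allI impI)
    show "U \<subseteq> Y" using W(2) by blast
  next
    fix t assume "(t, None) \<in> U"
    from nbhd[OF this] obtain G V where GV: "open G" "openin (one_point_discrete D) V" "t \<in> G"
      "None \<in> V" "({0..1} \<inter> G) \<times> V \<subseteq> W" by blast
    define F where "F = {d \<in> D. Some d \<notin> V}"
    have "finite (insert None (Some ` D) - V)"
      using GV(2,4) unfolding openin_one_point_discrete by blast
    moreover have "Some ` F \<subseteq> insert None (Some ` D) - V" by (auto simp: F_def)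
    ultimately have "finite (Some ` F)" by (rule rev_finite_subset)
    then have "finite F" by (rule finite_imageD) simp
    moreover have "Y \<inter> G \<times> (- Some ` F) \<subseteq> U"
    proof
      fix x assume x: "x \<in> Y \<inter> G \<times> (- Some ` F)"
      then have "x \<in> ({0..1} \<inter> G) \<times> V" using Y GV(4) by (auto simp: F_def)
      then have "x \<in> W" using GV(5) by (rule rev_subsetD)
      then show "x \<in> U" using W(2) x by simp
    qed
    ultimately show "\<exists>G F. open G \<and> t \<in> G \<and> finite F \<and> Y \<inter> G \<times> (- Some ` F) \<subseteq> U"
      using GV(1,3) by (intro exI[of _ G] exI[of _ F] conjI)
  next
    fix t d assume "(t, Some d) \<in> U"
    from nbhd[OF this] obtain G V where GV: "open G" "t \<in> G" "Some d \<in> V" "({0..1} \<inter> G) \<times> V \<subseteq> W"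
      by blast
    have "Y \<inter> G \<times> {Some d} \<subseteq> U"
    proof
      fix x assume x: "x \<in> Y \<inter> G \<times> {Some d}"
      then have "x \<in> ({0..1} \<inter> G) \<times> V" using Y GV(3) by auto
      then have "x \<in> W" using GV(4) by (rule rev_subsetD)
      then show "x \<in> U" using W(2) x by simp
    qed
    with GV(1,2) show "\<exists>G. open G \<and> t \<in> G \<and> Y \<inter> G \<times> {Some d} \<subseteq> U"
      by (intro exI[of _ G] conjI)
  qed
next
  assume R: ?R
  show ?L
  proof (subst openin_subopen, intro ballI)
    fix x assume x: "x \<in> U"
    obtain t u where tu: "x = (t, u)" by fastforce
    show "\<exists>T. openin (subtopology (unit_times_discrete D) Y) T \<and> x \<in> T \<and> T \<subseteq> U"
    proof (cases u)
      case None
      then obtain G F where G: "open G" "t \<in> G" "finite F" "Y \<inter> G \<times> (- Some ` F) \<subseteq> U"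
        using R x tu by meson
      have "x \<in> Y \<inter> G \<times> (- Some ` F)" using R x tu None G(2) by auto
      then show ?thesis using openin_cylinder[OF Y G(1,3)] G(4) by blast
    next
      case (Some d)
      then obtain G where G: "open G" "t \<in> G" "Y \<inter> G \<times> {Some d} \<subseteq> U"
        using R x tu by meson
      have "x \<in> Y \<inter> G \<times> {Some d}" using R x tu Some G(2) by auto
      then show ?thesis using openin_slice[OF Y G(1)] G(3) by blast
    qed
  qed
qed

section \<open>Separation, compactness and paracompactness\<close>

lemma Hausdorff_unit_times_discrete: "Hausdorff_space (unit_times_discrete D)"
  by (simp add: Hausdorff_space_prod_topology Hausdorff_space_Alexandroff_compactification
      locally_compact_space_discrete_topology Hausdorff_space_subtopology)

lemma compact_unit_times_discrete: "compact_space (unit_times_discrete D)"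
  by (simp add: compact_space_prod_topology compact_space_subtopology)

text \<open>Paracompactness is applied to the open sets whose closure lies in a member of
  \<open>\<C>\<close>; by regularity these still cover the union. Local finiteness is obtained only
  at points of the union, not at its boundary.\<close>

lemma locally_finite_closure_refinement:
  fixes \<C> :: "'a::{metric_space,second_countable_topology} set set"
  assumes "\<forall>C\<in>\<C>. open C"
  shows "\<exists>\<W>. \<Union>\<C> \<subseteq> \<Union>\<W> \<and> (\<forall>W\<in>\<W>. open W \<and> (\<exists>C\<in>\<C>. closure W \<subseteq> C)) \<and>
    (\<forall>x\<in>\<Union>\<C>. \<exists>N. open N \<and> x \<in> N \<and> finite {W \<in> \<W>. W \<inter> N \<noteq> {}})"
proof -
  define \<B> where "\<B> = {W. open W \<and> (\<exists>C\<in>\<C>. closure W \<subseteq> C)}"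
  have cover: "\<Union>\<C> \<subseteq> \<Union>\<B>"
  proof
    fix x assume "x \<in> \<Union>\<C>"
    then obtain C where C: "C \<in> \<C>" "x \<in> C" by blast
    then obtain e where e: "0 < e" "cball x e \<subseteq> C"
      using assms open_contains_cball by (metis)
    have "closure (ball x e) \<subseteq> cball x e" by (intro closure_minimal) auto
    then have "ball x e \<in> \<B>" using C(1) e(2) by (auto simp: \<B>_def)
    then show "x \<in> \<Union>\<B>" using e(1) by (meson UnionI centre_in_ball)
  qed
  have op: "open T" if "T \<in> \<B>" for T using that by (simp add: \<B>_def)
  show ?thesis
  proof (rule paracompact[OF cover op])
    fix \<W> assume W: "\<Union>\<C> \<subseteq> \<Union>\<W>" "\<And>U. U \<in> \<W> \<Longrightarrow> open U \<and> (\<exists>T. T \<in> \<B> \<and> U \<subseteq> T)"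
      "\<And>x. x \<in> \<Union>\<C> \<Longrightarrow> \<exists>V. open V \<and> x \<in> V \<and> finite {U. U \<in> \<W> \<and> U \<inter> V \<noteq> {}}"
    have "open W \<and> (\<exists>C\<in>\<C>. closure W \<subseteq> C)" if WW: "W \<in> \<W>" for W
    proof -
      obtain T where T: "T \<in> \<B>" "W \<subseteq> T" using W(2)[OF WW] by blast
      then obtain C where "C \<in> \<C>" "closure T \<subseteq> C" by (auto simp: \<B>_def)
      then show ?thesis using W(2)[OF WW] closure_mono[OF T(2)] by blast
    qed
    then show ?thesis using W(1,3) by (intro exI[of _ \<W>] conjI ballI) simp_all
  qed
qed

text \<open>
  Without the second hypothesis this fails: \<open>[0,1] \<times> \<alpha>D\<close> itself is not hereditarily paracompact for
  uncountable \<open>D\<close>. A cover of level \<open>\<infinity>\<close> is refined by cylinders over a locally finite family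
  \<open>\<C>\<close> of open sets with union \<open>V\<close>, which need not be locally finite at the boundary of \<open>V\<close>. In the
  slice of \<open>d\<close> the cylinders are therefore cut down to \<open>L (n d)\<close>, where the closed sets \<open>H m\<close>
  exhaust \<open>V\<close> and \<open>L m\<close> is open between \<open>H m\<close> and \<open>H (Suc m)\<close>; here \<open>n d\<close> is an index with \<open>H (n d)\<close> containing the part of the slice in \<open>V\<close>, and
  tends to infinity along the countably many exceptional \<open>d\<close>. The rest of the slice, outside the
  closed set \<open>Q d\<close>, is covered separately.
\<close>

lemma paracompact_subspace:
  assumes Y: "Y \<subseteq> topspace (unit_times_discrete D)"
    and cnt: "\<And>V. open V \<Longrightarrow>
      countable {d \<in> D. \<not> (\<exists>C. compact C \<and> C \<subseteq> V \<and> {t \<in> V. (t, Some d) \<in> Y} \<subseteq> C)}"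
  shows "paracompact_space (subtopology (unit_times_discrete D) Y)" (is "paracompact_space ?T")
  unfolding paracompact_space_def
proof (intro conjI allI impI)
  show "Hausdorff_space ?T"
    by (intro Hausdorff_space_subtopology Hausdorff_unit_times_discrete)
next
  fix \<U> assume \<U>: "(\<forall>U\<in>\<U>. openin ?T U) \<and> \<Union>\<U> = topspace ?T"
  have topY: "topspace ?T = Y" using Y by (auto simp only: topspace_subtopology)
  have \<U>Y: "\<Union>\<U> = Y" and \<U>op: "\<And>U. U \<in> \<U> \<Longrightarrow> openin ?T U" using \<U> unfolding topY by simp_all
  define \<C>\<^sub>0 where "\<C>\<^sub>0 = {G. open G \<and> (\<exists>F. finite F \<and> (\<exists>U\<in>\<U>. Y \<inter> G \<times> (- Some ` F) \<subseteq> U))}"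
  define V where "V = \<Union>\<C>\<^sub>0"
  have V: "t \<in> V" if tY: "(t, None) \<in> Y" for t
  proof -
    obtain U where U: "U \<in> \<U>" "(t, None) \<in> U" using tY unfolding \<U>Y[symmetric] by (rule UnionE)
    have "openin ?T U" using U(1) by (rule \<U>op)
    then obtain G F where G: "open G" "t \<in> G" "finite F" "Y \<inter> G \<times> (- Some ` F) \<subseteq> U"
      using U(2) unfolding openin_unit_times_discrete[OF Y] by meson
    then have "G \<in> \<C>\<^sub>0" unfolding \<C>\<^sub>0_def using U(1) by (intro CollectI conjI exI[of _ F] bexI[of _ U])
    then show ?thesis using G(2) unfolding V_def by (rule UnionI)
  qed
  have opC0: "\<forall>C\<in>\<C>\<^sub>0. open C" by (simp add: \<C>\<^sub>0_def)
  have openV: "open V" unfolding V_def using opC0 by (rule open_Union)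
  obtain \<C> where C: "\<Union>\<C>\<^sub>0 \<subseteq> \<Union>\<C>" "\<forall>W\<in>\<C>. open W \<and> (\<exists>C\<in>\<C>\<^sub>0. closure W \<subseteq> C)"
    "\<forall>x\<in>\<Union>\<C>\<^sub>0. \<exists>N. open N \<and> x \<in> N \<and> finite {W \<in> \<C>. W \<inter> N \<noteq> {}}"
    using locally_finite_closure_refinement[OF opC0] by (elim exE conjE) (rule that)
  have CV: "C \<subseteq> V" if "C \<in> \<C>" for C
    using C(2) that closure_subset[of C] unfolding V_def by blast
  have VC: "\<Union>\<C> = V" using C(1) CV unfolding V_def by blast
  have "\<forall>C\<in>\<C>. \<exists>F. finite F \<and> (\<exists>U\<in>\<U>. Y \<inter> C \<times> (- Some ` F) \<subseteq> U)"
  proof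
    fix C assume "C \<in> \<C>"
    then obtain C' where C': "C' \<in> \<C>\<^sub>0" "closure C \<subseteq> C'" using C(2) by blast
    then obtain F U where F: "finite F" "U \<in> \<U>" "Y \<inter> C' \<times> (- Some ` F) \<subseteq> U"
      unfolding \<C>\<^sub>0_def by blast
    have "C \<subseteq> C'" using C'(2) closure_subset by blast
    then have "Y \<inter> C \<times> (- Some ` F) \<subseteq> U" using F(3) by blast
    then show "\<exists>F. finite F \<and> (\<exists>U\<in>\<U>. Y \<inter> C \<times> (- Some ` F) \<subseteq> U)" using F(1,2) by blast
  qed
  from bchoice[OF this] obtain F where
    F: "\<forall>C\<in>\<C>. finite (F C) \<and> (\<exists>U\<in>\<U>. Y \<inter> C \<times> (- Some ` F C) \<subseteq> U)" by blast
  have opC: "\<forall>C\<in>\<C>. open C" using C(2) by blast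
  \<comment> \<open>The second refinement yields closed sets inside the members of
    \<open>\<C>\<close>: the sets \<open>Q d\<close> are built from closures of members of
    \<open>\<W>\<close> and are still covered by cylinders over \<open>\<C>\<close>.\<close>
  obtain \<W> where W: "V \<subseteq> \<Union>\<W>" "\<forall>W\<in>\<W>. open W \<and> (\<exists>C\<in>\<C>. closure W \<subseteq> C)"
    "\<forall>x\<in>V. \<exists>N. open N \<and> x \<in> N \<and> finite {W \<in> \<W>. W \<inter> N \<noteq> {}}"
    using locally_finite_closure_refinement[OF opC] unfolding VC by (elim exE conjE) (rule that)
  have "\<forall>W\<in>\<W>. \<exists>C. C \<in> \<C> \<and> closure W \<subseteq> C" using W(2) by blast
  from bchoice[OF this] obtain \<kappa> where \<kappa>: "\<forall>W\<in>\<W>. \<kappa> W \<in> \<C> \<and> closure W \<subseteq> \<kappa> W" by blast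
  define H where "H m = {t. ball t (1 / Suc m) \<subseteq> V}" for m :: nat
  have HV: "H m \<subseteq> V" for m by (auto simp: H_def)
  have Hmono: "H m \<subseteq> H k" if "m \<le> k" for m k
  proof -
    have "1 / Suc k \<le> 1 / Suc m" using that by (intro frac_le) auto
    then show ?thesis unfolding H_def by (auto dest: subset_ball[of _ _ "_::real"])
  qed
  have "- H m = (\<Union>s\<in>- V. ball s (1 / Suc m))" for m
    unfolding H_def by (auto simp: dist_commute)
  then have "open (- H m)" for m by (metis open_UN open_ball)
  then have Hclosed: "closed (H m)" for m by (simp add: closed_def)
  have Hball: "ball t (1 / Suc m) \<subseteq> H m" if "ball t (2 / Suc m) \<subseteq> V" for t m
  proof
    fix s assume s: "s \<in> ball t (1 / Suc m)"
    have "ball s (1 / Suc m) \<subseteq> ball t (2 / Suc m)"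
    proof
      fix r assume "r \<in> ball s (1 / Suc m)"
      then have "dist t r < 1 / Suc m + 1 / Suc m"
        using s dist_triangle[of t r s] unfolding mem_ball by linarith
      then show "r \<in> ball t (2 / Suc m)" by simp
    qed
    then show "s \<in> H m" using that unfolding H_def by blast
  qed
  define L where "L m = interior (H (Suc m))" for m
  have HL: "H m \<subseteq> L m" for m
  proof
    fix t assume t: "t \<in> H m"
    define e :: real where "e = 1 / Suc m - 1 / Suc (Suc m)"
    have e: "0 < e" unfolding e_def diff_gt_0_iff_gt by (intro divide_strict_left_mono) auto
    have "ball t e \<subseteq> H (Suc m)"
    proof
      fix s assume s: "s \<in> ball t e"
      have "ball s (1 / Suc (Suc m)) \<subseteq> ball t (1 / Suc m)"
      proof
        fix r assume "r \<in> ball s (1 / Suc (Suc m))"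
        then show "r \<in> ball t (1 / Suc m)"
          using s dist_triangle[of t r s] unfolding mem_ball e_def by linarith
      qed
      then show "s \<in> H (Suc m)" using t unfolding H_def by blast
    qed
    then show "t \<in> L m" unfolding L_def using e by (meson mem_interior)
  qed
  define E where "E = {d \<in> D. \<not> (\<exists>C. compact C \<and> C \<subseteq> V \<and> {t \<in> V. (t, Some d) \<in> Y} \<subseteq> C)}"
  have E: "countable E" unfolding E_def using cnt[OF openV] .
  have "\<forall>d\<in>D - E. \<exists>m. {t \<in> V. (t, Some d) \<in> Y} \<subseteq> H m"
  proof
    fix d assume "d \<in> D - E"
    then obtain C where C: "compact C" "C \<subseteq> V" "{t \<in> V. (t, Some d) \<in> Y} \<subseteq> C"
      unfolding E_def by blast
    obtain e where e: "e > 0" "(\<Union>x\<in>C. ball x e) \<subseteq> V"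
      using compact_subset_open_imp_ball_epsilon_subset[OF C(1) openV C(2)] by blast
    obtain m where m: "inverse (real (Suc m)) < e" using reals_Archimedean[OF e(1)] by blast
    have "C \<subseteq> H m"
    proof
      fix t assume "t \<in> C"
      then have "ball t e \<subseteq> V" using e(2) by blast
      moreover have "ball t (1 / Suc m) \<subseteq> ball t e"
        using m by (intro subset_ball) (simp add: inverse_eq_divide)
      ultimately show "t \<in> H m" unfolding H_def by blast
    qed
    then show "\<exists>m. {t \<in> V. (t, Some d) \<in> Y} \<subseteq> H m" using C(3) by blast
  qed
  from bchoice[OF this] obtain n0 where
    n0: "\<forall>d\<in>D - E. {t \<in> V. (t, Some d) \<in> Y} \<subseteq> H (n0 d)" by blast
  define n where "n d = (if d \<in> E then to_nat_on E d else n0 d)" for d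
  \<comment> \<open>Near a point of \<open>V\<close>, all but finitely many slices lie in their sets
    \<open>H (n d)\<close>. For \<open>d\<close> outside \<open>E\<close> this holds throughout
    \<open>V\<close>; for \<open>d\<close> in \<open>E\<close> it fails only if the index of
    \<open>d\<close> is below \<open>m\<close>, which leaves finitely many levels.\<close>
  have absorb: "\<exists>N F'. open N \<and> t \<in> N \<and> finite F' \<and>
      (\<forall>r d. r \<in> N \<longrightarrow> (r, Some d) \<in> Y \<longrightarrow> d \<notin> F' \<longrightarrow> r \<in> H (n d))" if tV: "t \<in> V" for t
  proof -
    obtain e where e: "e > 0" "ball t e \<subseteq> V" using openV tV by (meson open_contains_ball)
    obtain m where m: "inverse (real (Suc m)) < e / 2" using reals_Archimedean[of "e / 2"] e(1) by auto
    have "2 / Suc m \<le> e" using m by (simp add: inverse_eq_divide)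
    then have "ball t (2 / Suc m) \<subseteq> V" using e(2) subset_ball by blast
    then have N: "ball t (1 / Suc m) \<subseteq> H m" by (rule Hball)
    have "finite {d \<in> E. to_nat_on E d < m}"
    proof (rule finite_imageD)
      show "finite (to_nat_on E ` {d \<in> E. to_nat_on E d < m})"
        by (rule finite_subset[of _ "{..<m}"]) auto
      show "inj_on (to_nat_on E) {d \<in> E. to_nat_on E d < m}"
        using inj_on_to_nat_on[OF E] by (rule inj_on_subset) blast
    qed
    moreover have "r \<in> H (n d)" if r: "r \<in> ball t (1 / Suc m)" "(r, Some d) \<in> Y"
      "d \<notin> {d \<in> E. to_nat_on E d < m}" for r d
    proof (cases "d \<in> E")
      case True
      then have "m \<le> n d" using r(3) by (simp add: n_def)
      then show ?thesis using Hmono N r(1) by blast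
    next
      case False
      have "d \<in> D" using r(2) Y by auto
      moreover have "r \<in> V" using N r(1) HV by blast
      ultimately show ?thesis using n0 False r(2) by (auto simp: n_def)
    qed
    ultimately show ?thesis
      by (intro exI[of _ "ball t (1 / Suc m)"] exI[of _ "{d \<in> E. to_nat_on E d < m}"]) simp
  qed
  define Q where "Q d = (\<Union>W\<in>{W \<in> \<W>. d \<notin> F (\<kappa> W)}. closure W) \<inter> H (n d)" for d
  \<comment> \<open>The family \<open>\<W>\<close> is locally finite only in \<open>V\<close>.
    Intersecting with the closed set \<open>H (n d) \<subseteq> V\<close> keeps every closure point
    in that region.\<close>
  have Qclosed: "closed (Q d)" for d
  proof -
    have "t \<in> Q d" if t: "t \<in> closure (Q d)" for t
    proof -
      have tH: "t \<in> H (n d)"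
        using t closure_minimal[OF _ Hclosed, of "Q d" "n d"] by (auto simp: Q_def)
      then obtain N where N: "open N" "t \<in> N" "finite {W \<in> \<W>. W \<inter> N \<noteq> {}}"
        using W(3) HV by blast
      define Z where "Z = (\<Union>W\<in>{W \<in> \<W>. W \<inter> N \<noteq> {} \<and> d \<notin> F (\<kappa> W)}. closure W)"
      have "finite {W \<in> \<W>. W \<inter> N \<noteq> {} \<and> d \<notin> F (\<kappa> W)}"
        by (rule finite_subset[OF _ N(3)]) blast
      then have "closed Z" unfolding Z_def by (intro closed_UN) auto
      moreover have "N \<inter> Q d \<subseteq> Z"
      proof
        fix s assume s: "s \<in> N \<inter> Q d"
        then obtain W where W': "W \<in> \<W>" "d \<notin> F (\<kappa> W)" "s \<in> closure W" by (auto simp: Q_def)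
        then have "W \<inter> N \<noteq> {}" using s N(1) open_Int_closure_eq_empty[of N W] by blast
        then show "s \<in> Z" using W' by (auto simp: Z_def)
      qed
      ultimately have "closure (N \<inter> Q d) \<subseteq> Z" by (intro closure_minimal)
      then have "t \<in> Z" using open_Int_closure_subset[OF N(1), of "Q d"] N(2) t by blast
      then show ?thesis using tH by (auto simp: Z_def Q_def)
    qed
    then show ?thesis by (meson closure_subset_eq subsetI)
  qed
  define \<S> where "\<S> d = {G. open G \<and> (\<exists>U\<in>\<U>. Y \<inter> G \<times> {Some d} \<subseteq> U)}" for d
  have S: "t \<in> \<Union>(\<S> d)" if tY: "(t, Some d) \<in> Y" for t d
  proof -
    obtain U where U: "U \<in> \<U>" "(t, Some d) \<in> U" using tY unfolding \<U>Y[symmetric] by (rule UnionE)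
    have "openin ?T U" using U(1) by (rule \<U>op)
    then obtain G where "open G" "t \<in> G" "Y \<inter> G \<times> {Some d} \<subseteq> U"
      using U(2) unfolding openin_unit_times_discrete[OF Y] by meson
    then show ?thesis using U(1) unfolding \<S>_def by (intro UnionI[of G] CollectI conjI bexI[of _ U])
  qed
  have "\<forall>d. \<exists>\<G>. \<Union>(\<S> d) \<subseteq> \<Union>\<G> \<and> (\<forall>W\<in>\<G>. open W \<and> (\<exists>C\<in>\<S> d. closure W \<subseteq> C)) \<and>
    (\<forall>x\<in>\<Union>(\<S> d). \<exists>N. open N \<and> x \<in> N \<and> finite {W \<in> \<G>. W \<inter> N \<noteq> {}})"
    by (intro allI locally_finite_closure_refinement) (simp add: \<S>_def)
  from choice[OF this] obtain \<G> where
    G: "\<forall>d. \<Union>(\<S> d) \<subseteq> \<Union>(\<G> d) \<and> (\<forall>W\<in>\<G> d. open W \<and> (\<exists>C\<in>\<S> d. closure W \<subseteq> C)) \<and>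
    (\<forall>x\<in>\<Union>(\<S> d). \<exists>N. open N \<and> x \<in> N \<and> finite {W \<in> \<G> d. W \<inter> N \<noteq> {}})" by blast
  have Gref: "\<exists>C\<in>\<S> d. closure W \<subseteq> C" if "W \<in> \<G> d" for W d
    using spec[OF G, of d] that by simp
  have Gfin: "\<exists>N. open N \<and> t \<in> N \<and> finite {W \<in> \<G> d. W \<inter> N \<noteq> {}}" if "t \<in> \<Union>(\<S> d)" for t d
    using spec[OF G, of d] that by (elim conjE) (rule bspec)
  define cyl where "cyl C = {(s, u). (s, u) \<in> Y \<and> s \<in> C \<and> u \<notin> Some ` F C \<and> (\<forall>d. u = Some d \<longrightarrow> s \<in> L (n d))}" for C
  define sli where "sli d G = Y \<inter> (G - Q d) \<times> {Some d}" for d G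
  define \<V> where "\<V> = cyl ` \<C> \<union> (\<Union>d. sli d ` \<G> d)"
  have cyl_open: "openin ?T (cyl C)" if C': "C \<in> \<C>" for C
    unfolding openin_unit_times_discrete[OF Y]
  proof (intro conjI allI impI)
    show "cyl C \<subseteq> Y" by (auto simp: cyl_def)
  next
    fix t assume "(t, None) \<in> cyl C"
    then have t: "t \<in> C" by (simp add: cyl_def)
    then have "t \<in> V" using CV[OF C'] by blast
    then obtain N F' where N: "open N" "t \<in> N" "finite F'"
      "\<forall>r d. r \<in> N \<longrightarrow> (r, Some d) \<in> Y \<longrightarrow> d \<notin> F' \<longrightarrow> r \<in> H (n d)" using absorb by meson
    have "Y \<inter> (N \<inter> C) \<times> (- Some ` (F C \<union> F')) \<subseteq> cyl C"
    proof
      fix x assume x: "x \<in> Y \<inter> (N \<inter> C) \<times> (- Some ` (F C \<union> F'))"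
      obtain s u where su: "x = (s, u)" by fastforce
      have "s \<in> L (n d)" if "u = Some d" for d
      proof -
        have "s \<in> N" "(s, Some d) \<in> Y" "d \<notin> F'" using x su that by auto
        then have "s \<in> H (n d)" using N(4) by blast
        then show ?thesis using HL by blast
      qed
      then show "x \<in> cyl C" using x su by (auto simp: cyl_def)
    qed
    moreover have "open (N \<inter> C)" "finite (F C \<union> F')" using N bspec[OF opC C'] F C' by auto
    ultimately show "\<exists>G F. open G \<and> t \<in> G \<and> finite F \<and> Y \<inter> G \<times> (- Some ` F) \<subseteq> cyl C"
      using t N(2) by (intro exI[of _ "N \<inter> C"] exI[of _ "F C \<union> F'"]) simp
  next
    fix t d assume t: "(t, Some d) \<in> cyl C"
    have "open (C \<inter> L (n d))" using bspec[OF opC C'] by (simp add: L_def open_Int)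
    moreover have "Y \<inter> (C \<inter> L (n d)) \<times> {Some d} \<subseteq> cyl C" using t by (auto simp: cyl_def)
    moreover have "t \<in> C \<inter> L (n d)" using t by (simp add: cyl_def)
    ultimately show "\<exists>G. open G \<and> t \<in> G \<and> Y \<inter> G \<times> {Some d} \<subseteq> cyl C" by (intro exI conjI)
  qed
  have sli_open: "openin ?T (sli d G')" if G': "G' \<in> \<G> d" for d G'
  proof -
    have "open (G' - Q d)" using G G' Qclosed by (intro open_Diff) auto
    then show ?thesis unfolding sli_def by (rule openin_slice[OF Y])
  qed
  have Vopen: "\<forall>V\<in>\<V>. openin ?T V" unfolding \<V>_def using cyl_open sli_open by blast
  have VY: "\<Union>\<V> \<subseteq> Y" by (auto simp: \<V>_def cyl_def sli_def)
  have YV: "x \<in> \<Union>\<V>" if x: "x \<in> Y" for x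
  proof -
    obtain t u where tu: "x = (t, u)" by fastforce
    show ?thesis
    proof (cases u)
      case None
      then have "t \<in> V" using x tu V by simp
      then obtain C where "C \<in> \<C>" "t \<in> C" using VC by blast
      then have "x \<in> cyl C" "cyl C \<in> \<V>" using x tu None by (auto simp: cyl_def \<V>_def)
      then show ?thesis by blast
    next
      case (Some d)
      show ?thesis
      proof (cases "t \<in> Q d")
        case True
        then obtain W where W': "W \<in> \<W>" "d \<notin> F (\<kappa> W)" "t \<in> closure W" "t \<in> H (n d)"
          by (auto simp: Q_def)
        have "t \<in> L (n d)" using HL W'(4) by (rule subsetD)
        moreover have "t \<in> \<kappa> W" "\<kappa> W \<in> \<C>" using bspec[OF \<kappa> W'(1)] W'(3) by auto
        ultimately have "x \<in> cyl (\<kappa> W)" "cyl (\<kappa> W) \<in> \<V>" using x tu Some W'(2) by (auto simp: cyl_def \<V>_def)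
        then show ?thesis by blast
      next
        case False
        have "t \<in> \<Union>(\<S> d)" using S x tu Some by simp
        then obtain G' where "G' \<in> \<G> d" "t \<in> G'" using G by blast
        then have "x \<in> sli d G'" "sli d G' \<in> \<V>" using x tu Some False by (auto simp: sli_def \<V>_def)
        then show ?thesis by blast
      qed
    qed
  qed
  have refine: "\<exists>U\<in>\<U>. A \<subseteq> U" if A: "A \<in> \<V>" for A
  proof -
    consider C where "C \<in> \<C>" "A = cyl C" | d G' where "G' \<in> \<G> d" "A = sli d G'"
      using A by (auto simp: \<V>_def)
    then show ?thesis
    proof cases
      case 1
      have "cyl C \<subseteq> Y \<inter> C \<times> (- Some ` F C)" by (auto simp: cyl_def)
      then show ?thesis using F 1 by (meson subset_trans)
    next
      case 2
      obtain G'' where G'': "G'' \<in> \<S> d" "closure G' \<subseteq> G''" using Gref[OF 2(1)] by blast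
      then obtain U where U: "closure G' \<subseteq> G''" "U \<in> \<U>" "Y \<inter> G'' \<times> {Some d} \<subseteq> U"
        unfolding \<S>_def by blast
      have "sli d G' \<subseteq> Y \<inter> G'' \<times> {Some d}" using U(1) closure_subset[of G'] by (auto simp: sli_def)
      then show ?thesis using U 2 by blast
    qed
  qed
  have locfin: "\<exists>N. openin ?T N \<and> x \<in> N \<and> finite {A \<in> \<V>. A \<inter> N \<noteq> {}}" if x: "x \<in> Y" for x
  proof -
    obtain t u where tu: "x = (t, u)" by fastforce
    show ?thesis
    proof (cases u)
      case None
      then have t: "t \<in> V" using x tu V by simp
      obtain W where W': "W \<in> \<W>" "t \<in> W" using t W(1) by blast
      obtain N1 where N1: "open N1" "t \<in> N1" "finite {C \<in> \<C>. C \<inter> N1 \<noteq> {}}"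
        using C(3) t unfolding V_def by blast
      obtain N2 F2 where N2: "open N2" "t \<in> N2" "finite F2"
        "\<forall>r d. r \<in> N2 \<longrightarrow> (r, Some d) \<in> Y \<longrightarrow> d \<notin> F2 \<longrightarrow> r \<in> H (n d)" using absorb[OF t] by meson
      define N where "N = Y \<inter> (N1 \<inter> N2 \<inter> W) \<times> (- Some ` (F (\<kappa> W) \<union> F2))"
      have "open (N1 \<inter> N2 \<inter> W)" using N1(1) N2(1) W(2) W'(1) by (intro open_Int) auto
      moreover have "finite (F (\<kappa> W) \<union> F2)" using N2(3) F \<kappa> W'(1) by blast
      ultimately have "openin ?T N" unfolding N_def by (rule openin_cylinder[OF Y])
      moreover have "x \<in> N" using x tu None N1(2) N2(2) W'(2) by (auto simp: N_def)
      \<comment> \<open>No slice piece meets \<open>N\<close>: a point of \<open>N\<close> at a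
        level \<open>d\<close> lies in \<open>W\<close> and in \<open>H (n d)\<close>, hence in
        \<open>Q d\<close>, which was removed from the slice pieces.\<close>
      moreover have "{A \<in> \<V>. A \<inter> N \<noteq> {}} \<subseteq> cyl ` {C \<in> \<C>. C \<inter> N1 \<noteq> {}}"
      proof
        fix A assume A: "A \<in> {A \<in> \<V>. A \<inter> N \<noteq> {}}"
        then obtain s v where sv: "(s, v) \<in> A" "(s, v) \<in> N" by auto
        consider C where "C \<in> \<C>" "A = cyl C" | d G' where "G' \<in> \<G> d" "A = sli d G'"
          using A by (auto simp: \<V>_def)
        then show "A \<in> cyl ` {C \<in> \<C>. C \<inter> N1 \<noteq> {}}"
        proof cases
          case 1
          then have "s \<in> C \<inter> N1" using sv by (auto simp: cyl_def N_def)
          then show ?thesis using 1 by blast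
        next
          case 2
          then have s: "v = Some d" "s \<notin> Q d" "(s, Some d) \<in> Y" using sv by (auto simp: sli_def)
          then have s': "d \<notin> F (\<kappa> W)" "d \<notin> F2" "s \<in> W" "s \<in> N2" using sv by (auto simp: N_def)
          then have "s \<in> H (n d)" using N2(4) s(3) by blast
          moreover have "s \<in> closure W" using s'(3) closure_subset by blast
          ultimately have "s \<in> Q d" using W'(1) s'(1) by (auto simp: Q_def)
          then show ?thesis using s(2) by blast
        qed
      qed
      then have "finite {A \<in> \<V>. A \<inter> N \<noteq> {}}" using N1(3) by (meson finite_imageI finite_subset)
      ultimately show ?thesis by (intro exI[of _ N] conjI)
    next
      case (Some d)
      have "\<exists>N. open N \<and> t \<in> N \<and> finite {C \<in> \<C>. C \<inter> L (n d) \<inter> N \<noteq> {}}"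
      proof (cases "t \<in> V")
        case True
        then obtain N1 where N1: "open N1" "t \<in> N1" "finite {C \<in> \<C>. C \<inter> N1 \<noteq> {}}"
          using C(3) unfolding V_def by blast
        have "finite {C \<in> \<C>. C \<inter> L (n d) \<inter> N1 \<noteq> {}}" by (rule finite_subset[OF _ N1(3)]) blast
        then show ?thesis using N1(1,2) by blast
      next
        \<comment> \<open>This is the boundary problem of the cylinders. Cut down to
          \<open>L (n d)\<close>, they stay inside the closed subset \<open>H (Suc (n d))\<close> of
          \<open>V\<close>, whose complement is a neighbourhood of \<open>t\<close>.\<close>
        case False
        have "L (n d) \<subseteq> H (Suc (n d))" unfolding L_def by (rule interior_subset)
        then have "{C \<in> \<C>. C \<inter> L (n d) \<inter> - H (Suc (n d)) \<noteq> {}} = {}" by blast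
        then have "finite {C \<in> \<C>. C \<inter> L (n d) \<inter> - H (Suc (n d)) \<noteq> {}}" by (simp only: finite.emptyI)
        moreover have "t \<in> - H (Suc (n d))" using False HV by blast
        moreover have "open (- H (Suc (n d)))" using Hclosed by (simp add: open_Compl)
        ultimately show ?thesis by (intro exI[of _ "- H (Suc (n d))"] conjI)
      qed
      then obtain N1 where N1: "open N1" "t \<in> N1" "finite {C \<in> \<C>. C \<inter> L (n d) \<inter> N1 \<noteq> {}}" by blast
      have "t \<in> \<Union>(\<S> d)" using S x tu Some by simp
      then obtain N2 where N2: "open N2" "t \<in> N2" "finite {G' \<in> \<G> d. G' \<inter> N2 \<noteq> {}}"
        using Gfin by meson
      define N where "N = Y \<inter> (N1 \<inter> N2) \<times> {Some d}"
      have "openin ?T N" unfolding N_def using N1(1) N2(1) by (intro openin_slice[OF Y] open_Int)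
      moreover have "x \<in> N" using x tu Some N1(2) N2(2) by (auto simp: N_def)
      moreover have "{A \<in> \<V>. A \<inter> N \<noteq> {}} \<subseteq>
          cyl ` {C \<in> \<C>. C \<inter> L (n d) \<inter> N1 \<noteq> {}} \<union> sli d ` {G' \<in> \<G> d. G' \<inter> N2 \<noteq> {}}"
      proof
        fix A assume A: "A \<in> {A \<in> \<V>. A \<inter> N \<noteq> {}}"
        then obtain s where s: "(s, Some d) \<in> A" "s \<in> N1" "s \<in> N2" by (auto simp: N_def)
        consider C where "C \<in> \<C>" "A = cyl C" | d' G' where "G' \<in> \<G> d'" "A = sli d' G'"
          using A by (auto simp: \<V>_def)
        then show "A \<in> cyl ` {C \<in> \<C>. C \<inter> L (n d) \<inter> N1 \<noteq> {}} \<union> sli d ` {G' \<in> \<G> d. G' \<inter> N2 \<noteq> {}}"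
        proof cases
          case 1
          then have "s \<in> C \<inter> L (n d) \<inter> N1" using s by (auto simp: cyl_def)
          then show ?thesis using 1 by blast
        next
          case 2
          then have "d' = d" "s \<in> G' \<inter> N2" using s by (auto simp: sli_def)
          then show ?thesis using 2 by blast
        qed
      qed
      then have "finite {A \<in> \<V>. A \<inter> N \<noteq> {}}"
        using N1(3) N2(3) by (meson finite_UnI finite_imageI finite_subset)
      ultimately show ?thesis by (intro exI[of _ N] conjI)
    qed
  qed
  have cov: "\<Union>\<V> = Y" using VY YV by blast
  show "\<exists>\<V>. (\<forall>V\<in>\<V>. openin ?T V) \<and> \<Union>\<V> = topspace ?T \<and> (\<forall>V\<in>\<V>. \<exists>U\<in>\<U>. V \<subseteq> U) \<and> locally_finite_in ?T \<V>"
    unfolding locally_finite_in_def topY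
    using Vopen cov VY refine locfin by (intro exI[of _ \<V>] conjI ballI) simp_all
qed

section \<open>Sets attached to the interval\<close>

lemma base_of_iff:
  "base_of X \<B> \<longleftrightarrow> (\<forall>B\<in>\<B>. openin X B) \<and> (\<forall>U x. openin X U \<longrightarrow> x \<in> U \<longrightarrow> (\<exists>B\<in>\<B>. x \<in> B \<and> B \<subseteq> U))"
proof
  assume L: "base_of X \<B>"
  have "openin X B" if "B \<in> \<B>" for B
    using L that unfolding base_of_def by (simp add: arbitrary_union_of_inc)
  moreover have "\<exists>B\<in>\<B>. x \<in> B \<and> B \<subseteq> U" if "openin X U" "x \<in> U" for U x
  proof -
    have "(arbitrary union_of (\<lambda>U. U \<in> \<B>)) U"
      using that(1) unfolding L[unfolded base_of_def] .
    then show ?thesis using that(2) unfolding arbitrary_union_of_alt by blast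
  qed
  ultimately show "(\<forall>B\<in>\<B>. openin X B) \<and> (\<forall>U x. openin X U \<longrightarrow> x \<in> U \<longrightarrow> (\<exists>B\<in>\<B>. x \<in> B \<and> B \<subseteq> U))"
    by simp
next
  assume R: "(\<forall>B\<in>\<B>. openin X B) \<and> (\<forall>U x. openin X U \<longrightarrow> x \<in> U \<longrightarrow> (\<exists>B\<in>\<B>. x \<in> B \<and> B \<subseteq> U))"
  show "base_of X \<B>"
    unfolding base_of_def
  proof (rule ext)
    fix U
    have "openin X U" if U: "\<forall>x\<in>U. \<exists>B. B \<in> \<B> \<and> x \<in> B \<and> B \<subseteq> U"
    proof (subst openin_subopen, rule ballI)
      fix x assume "x \<in> U"
      with U obtain B where "B \<in> \<B>" "x \<in> B" "B \<subseteq> U" by blast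
      then show "\<exists>T. openin X T \<and> x \<in> T \<and> T \<subseteq> U" using R by blast
    qed
    then show "openin X U = (arbitrary union_of (\<lambda>U. U \<in> \<B>)) U"
      unfolding arbitrary_union_of_alt using R by blast
  qed
qed

lemma weight_eqI:
  fixes r :: "'b rel"
  assumes "base_of X \<B>" "|\<B>| \<le>o r" "\<And>\<A>. base_of X \<A> \<Longrightarrow> r \<le>o |\<A>|"
  shows "weight X =o r"
proof -
  have "{\<B>. base_of X \<B>} \<noteq> {}" using assms(1) by blast
  from min_card[OF this] obtain \<A> where A: "base_of X \<A>" "weight X = |\<A>|"
    "\<forall>B\<in>{\<B>. base_of X \<B>}. |\<A>| \<le>o |B|"
    unfolding weight_def by blast
  then have "|\<A>| \<le>o |\<B>|" using assms(1) by blast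
  then have "|\<A>| \<le>o r" using assms(2) by (rule ordLeq_transitive)
  then show ?thesis using assms(3)[OF A(1)] A(2) by (simp add: ordIso_iff_ordLeq)
qed

lemma card_of_finite_subsets_ordLeq:
  assumes "infinite (Field r)" "Card_order r" "|A| \<le>o r"
  shows "|{F. finite F \<and> F \<subseteq> A}| \<le>o r"
proof -
  have nat: "|UNIV :: nat set| \<le>o r"
    using assms(1,2) by (meson card_of_Field_ordIso infinite_iff_card_of_nat ordLeq_ordIso_trans)
  then have natLeq: "natLeq \<le>o r"
    using card_of_nat ordIso_symmetric ordIso_ordLeq_trans by blast
  have "|{xs. set xs \<subseteq> A \<and> length xs = n}| \<le>o r" for n
  proof (induction n)
    case 0
    have "{xs. set xs \<subseteq> A \<and> length xs = 0} = {[]}" by auto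
    then have "|{xs. set xs \<subseteq> A \<and> length xs = 0}| \<le>o natLeq"
      unfolding countable_iff_card_of[symmetric] by simp
    then show ?case using natLeq by (rule ordLeq_transitive)
  next
    case (Suc n)
    have "{xs. set xs \<subseteq> A \<and> length xs = Suc n} \<subseteq> (\<lambda>(x, xs). x # xs) ` (A \<times> {xs. set xs \<subseteq> A \<and> length xs = n})"
    proof
      fix xs assume "xs \<in> {xs. set xs \<subseteq> A \<and> length xs = Suc n}"
      then show "xs \<in> (\<lambda>(x, xs). x # xs) ` (A \<times> {xs. set xs \<subseteq> A \<and> length xs = n})"
        by (cases xs) auto
    qed
    moreover have "|A \<times> {xs. set xs \<subseteq> A \<and> length xs = n}| \<le>o r"
      using assms Suc by (intro card_of_Times_ordLeq_infinite_Field)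
    ultimately show ?case by (meson card_of_image card_of_mono1 ordLeq_transitive)
  qed
  then have "|\<Union>n\<in>UNIV. {xs. set xs \<subseteq> A \<and> length xs = n}| \<le>o r"
    using assms(1,2) nat by (intro card_of_UNION_ordLeq_infinite_Field) simp_all
  moreover have "{F. finite F \<and> F \<subseteq> A} \<subseteq> set ` (\<Union>n\<in>UNIV. {xs. set xs \<subseteq> A \<and> length xs = n})"
  proof
    fix F assume F: "F \<in> {F. finite F \<and> F \<subseteq> A}"
    then obtain xs where "set xs = F" using finite_list by blast
    then show "F \<in> set ` (\<Union>n\<in>UNIV. {xs. set xs \<subseteq> A \<and> length xs = n})" using F by blast
  qed
  ultimately show ?thesis by (meson card_of_image card_of_mono1 ordLeq_transitive)
qed

lemma rational_interval_in_open:
  assumes "open G" "(t::real) \<in> G"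
  shows "\<exists>a b :: rat. t \<in> {of_rat a<..<of_rat b} \<and> {of_rat a<..<of_rat b} \<subseteq> G"
proof -
  obtain e where e: "0 < e" "ball t e \<subseteq> G" using assms by (meson open_contains_ball)
  obtain a :: rat where a: "t - e < of_rat a" "of_rat a < t" using of_rat_dense[of "t - e" t] e(1) by auto
  obtain b :: rat where b: "t < of_rat b" "of_rat b < t + e" using of_rat_dense[of t "t + e"] e(1) by auto
  have "{of_rat a<..<of_rat b} \<subseteq> ball t e" using a b by (auto simp: dist_real_def)
  then have "t \<in> {of_rat a<..<of_rat b} \<and> {of_rat a<..<of_rat b} \<subseteq> G" using a b e(2) by auto
  then show ?thesis by blast
qed

section \<open>The interval with a closed set at each level\<close>

definition attached :: "'a set \<Rightarrow> ('a \<Rightarrow> real set) \<Rightarrow> (real \<times> 'a option) set" where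
  "attached D K = {0..1} \<times> {None} \<union> (\<Union>d\<in>D. K d \<times> {Some d})"

locale attached_sets =
  fixes D D' :: "'a set" and K :: "'a \<Rightarrow> real set"
  assumes D': "D' \<subseteq> D"
    and closed_K: "\<And>d. d \<in> D' \<Longrightarrow> closed (K d)"
    and K_subset: "\<And>d. d \<in> D' \<Longrightarrow> K d \<subseteq> {0..1}"
begin

abbreviation "X \<equiv> attached D' K"
abbreviation "T \<equiv> subtopology (unit_times_discrete D) X"

lemma mem_X_None [simp]: "(t, None) \<in> X \<longleftrightarrow> t \<in> {0..1}"
  by (auto simp: attached_def)

lemma mem_X_Some [simp]: "(t, Some d) \<in> X \<longleftrightarrow> d \<in> D' \<and> t \<in> K d"
  by (auto simp: attached_def)

lemma X_subset: "X \<subseteq> topspace (unit_times_discrete D)"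
  using D' K_subset by (auto simp: attached_def)

lemma topspace_T: "topspace T = X"
  using X_subset by (simp only: topspace_subtopology Int_absorb1)

lemmas openin_T = openin_unit_times_discrete[OF X_subset]

lemma closedin_X: "closedin (unit_times_discrete D) X"
  unfolding closedin_def
proof (intro conjI X_subset)
  let ?P = "topspace (unit_times_discrete D)"
  have "openin (subtopology (unit_times_discrete D) ?P) (?P - X)"
    unfolding openin_unit_times_discrete[OF order_refl]
  proof (intro conjI allI impI)
    fix t assume "(t, None) \<in> ?P - X"
    then show "\<exists>G F. open G \<and> t \<in> G \<and> finite F \<and> ?P \<inter> G \<times> (- Some ` F) \<subseteq> ?P - X" by auto
  next
    fix t d assume t: "(t, Some d) \<in> ?P - X"
    show "\<exists>G. open G \<and> t \<in> G \<and> ?P \<inter> G \<times> {Some d} \<subseteq> ?P - X"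
    proof (cases "d \<in> D'")
      case True
      then have "open (- K d)" "t \<in> - K d" using t closed_K by auto
      moreover have "?P \<inter> (- K d) \<times> {Some d} \<subseteq> ?P - X" by auto
      ultimately show ?thesis by (intro exI[of _ "- K d"] conjI)
    next
      case False
      then have "?P \<inter> UNIV \<times> {Some d} \<subseteq> ?P - X" by auto
      then show ?thesis by (intro exI[of _ UNIV]) simp
    qed
  qed blast
  then show "openin (unit_times_discrete D) (?P - X)" by (simp only: subtopology_topspace)
qed

lemma openin_T_cylinder: "open G \<Longrightarrow> finite F \<Longrightarrow> openin T (X \<inter> G \<times> (- Some ` F))"
  by (rule openin_cylinder[OF X_subset])

lemma openin_T_slice: "open G \<Longrightarrow> openin T (X \<inter> G \<times> {Some d})"
  by (rule openin_slice[OF X_subset])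

text \<open>At a point \<open>(t, None)\<close> only the finite sets of levels \<open>d\<close> with
  \<open>t \<in> K d\<close> have to be removed, and these are countably many. Any other level is
  avoided by shrinking the interval around \<open>t\<close>, because \<open>K d\<close> is
  closed.\<close>

lemma first_countable_T:
  assumes "\<And>t. countable {d \<in> D'. t \<in> K d}"
  shows "first_countable T"
  unfolding first_countable_def topspace_T
proof
  fix x assume x: "x \<in> X"
  obtain t u where tu: "x = (t, u)" by fastforce
  show "\<exists>\<B>. countable \<B> \<and> (\<forall>V\<in>\<B>. openin T V) \<and> (\<forall>U. openin T U \<and> x \<in> U \<longrightarrow> (\<exists>V\<in>\<B>. x \<in> V \<and> V \<subseteq> U))"
  proof (cases u)
    case None
    define \<F> where "\<F> = {F. F \<subseteq> {d \<in> D'. t \<in> K d} \<and> finite F}"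
    define B where "B = (\<lambda>((a :: rat, b :: rat), F). X \<inter> {of_rat a<..<of_rat b} \<times> (- Some ` F))"
    define \<B> where "\<B> = B ` (UNIV \<times> \<F>)"
    have "countable \<F>" unfolding \<F>_def using countable_Collect_finite_subset[OF assms[of t]]
      by (simp add: conj_commute)
    then have "countable \<B>" by (simp add: \<B>_def)
    moreover have "\<forall>V\<in>\<B>. openin T V"
      unfolding \<B>_def B_def \<F>_def by (auto intro!: openin_T_cylinder)
    moreover have "\<exists>V\<in>\<B>. x \<in> V \<and> V \<subseteq> U" if U: "openin T U" "x \<in> U" for U
    proof -
      obtain G F where G: "open G" "t \<in> G" "finite F" "X \<inter> G \<times> (- Some ` F) \<subseteq> U"
        using U tu None unfolding openin_T by meson
      define F1 where "F1 = {d \<in> F. d \<in> D' \<and> t \<in> K d}"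
      define F2 where "F2 = {d \<in> F. d \<in> D' \<and> t \<notin> K d}"
      have fin: "finite F1" "finite F2" using G(3) by (auto simp: F1_def F2_def)
      have "open (G - (\<Union>d\<in>F2. K d))"
        using G(1) fin(2) closed_K by (intro open_Diff closed_UN) (auto simp: F2_def)
      moreover have "t \<in> G - (\<Union>d\<in>F2. K d)" using G(2) by (auto simp: F2_def)
      ultimately obtain a b :: rat where ab: "t \<in> {of_rat a<..<of_rat b}"
        "{of_rat a<..<of_rat b} \<subseteq> G - (\<Union>d\<in>F2. K d)"
        using rational_interval_in_open by meson
      define V where "V = B ((a, b), F1)"
      have "V \<in> \<B>" using fin(1) by (auto simp: V_def \<B>_def \<F>_def F1_def)
      moreover have "x \<in> V" using x tu None ab(1) by (simp add: V_def B_def)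
      moreover have "V \<subseteq> U"
      proof
        fix y assume y: "y \<in> V"
        obtain s v where sv: "y = (s, v)" by fastforce
        have s: "s \<in> G" "s \<notin> (\<Union>d\<in>F2. K d)" "y \<in> X" "v \<notin> Some ` F1"
          using y sv ab(2) by (auto simp: V_def B_def)
        have "v \<notin> Some ` F"
        proof
          assume "v \<in> Some ` F"
          then obtain d where d: "d \<in> F" "v = Some d" by blast
          then have "d \<in> D'" "s \<in> K d" using s(3) sv by simp_all
          then show False using d s(2,4) by (auto simp: F1_def F2_def)
        qed
        then have "y \<in> X \<inter> G \<times> (- Some ` F)" using s sv by simp
        then show "y \<in> U" using G(4) by (rule rev_subsetD)
      qed
      ultimately show ?thesis by (intro bexI[of _ V] conjI)
    qed
    ultimately show ?thesis by (intro exI[of _ \<B>]) simp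
  next
    case (Some d)
    define B where "B = (\<lambda>(a :: rat, b :: rat). X \<inter> {of_rat a<..<of_rat b} \<times> {Some d})"
    have "\<exists>V\<in>range B. x \<in> V \<and> V \<subseteq> U" if U: "openin T U" "x \<in> U" for U
    proof -
      obtain G where G: "open G" "t \<in> G" "X \<inter> G \<times> {Some d} \<subseteq> U"
        using U tu Some unfolding openin_T by meson
      obtain a b :: rat where ab: "t \<in> {of_rat a<..<of_rat b}" "{of_rat a<..<of_rat b} \<subseteq> G"
        using rational_interval_in_open[OF G(1,2)] by meson
      have "x \<in> B (a, b)" using x tu Some ab(1) by (simp add: B_def)
      moreover have "B (a, b) \<subseteq> X \<inter> G \<times> {Some d}" using ab(2) by (auto simp: B_def)
      ultimately show ?thesis using G(3) by blast
    qed
    moreover have "\<forall>V\<in>range B. openin T V" by (auto simp: B_def intro!: openin_T_slice)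
    ultimately show ?thesis by (intro exI[of _ "range B"]) simp
  qed
qed

text \<open>Whenever \<open>K d \<inter> V\<close> is compact, it serves as the compact set required
  by \<open>paracompact_subspace\<close> for every subspace at once.\<close>

lemma hereditarily_paracompact_T:
  assumes "\<And>V. open V \<Longrightarrow> countable {d \<in> D'. \<not> compact (K d \<inter> V)}"
  shows "hereditarily_paracompact T"
  unfolding hereditarily_paracompact_def topspace_T
proof (intro allI impI)
  fix S assume S: "S \<subseteq> X"
  have "paracompact_space (subtopology (unit_times_discrete D) S)"
  proof (rule paracompact_subspace)
    show "S \<subseteq> topspace (unit_times_discrete D)" using S X_subset by (rule subset_trans)
    fix V :: "real set" assume V: "open V"
    have "\<exists>C. compact C \<and> C \<subseteq> V \<and> {t \<in> V. (t, Some d) \<in> S} \<subseteq> C"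
      if "d \<notin> {d \<in> D'. \<not> compact (K d \<inter> V)}" for d
    proof (cases "d \<in> D'")
      case True
      have "{t \<in> V. (t, Some d) \<in> S} \<subseteq> K d \<inter> V" using S by auto
      then show ?thesis using that True by (intro exI[of _ "K d \<inter> V"]) simp
    next
      case False
      then have "{t \<in> V. (t, Some d) \<in> S} = {}" using S by auto
      then show ?thesis by (intro exI[of _ "{}"]) simp
    qed
    then have "{d \<in> D. \<not> (\<exists>C. compact C \<and> C \<subseteq> V \<and> {t \<in> V. (t, Some d) \<in> S} \<subseteq> C)} \<subseteq>
        {d \<in> D'. \<not> compact (K d \<inter> V)}" by blast
    then show "countable {d \<in> D. \<not> (\<exists>C. compact C \<and> C \<subseteq> V \<and> {t \<in> V. (t, Some d) \<in> S} \<subseteq> C)}"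
      using assms[OF V] by (rule countable_subset)
  qed
  then show "paracompact_space (subtopology T S)"
    using S by (simp add: subtopology_subtopology Int_absorb1)
qed

text \<open>Upper bound: rational intervals together with finite subsets or elements of
  \<open>D'\<close> index a base. Lower bound: the slices are disjoint, nonempty and open, so each
  contains a base member of its own.\<close>

lemma weight_T:
  assumes D'_omega1: "|D'| =o omega1" and nonempty: "\<And>d. d \<in> D' \<Longrightarrow> K d \<noteq> {}"
  shows "weight T =o omega1"
proof -
  have co: "Card_order omega1" by (simp add: cardSuc_Card_order natLeq_Card_order)
  have inf: "infinite (Field omega1)"
    using cardSuc_finite natLeq_Card_order by (metis Field_natLeq infinite_UNIV_nat)
  have ctbl: "|A| \<le>o omega1" if "countable A" for A
  proof -
    have "|A| \<le>o natLeq" using that by (simp add: countable_iff_card_of)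
    then show ?thesis using cardSuc_greater[OF natLeq_Card_order] by (meson ordLeq_ordLess_trans ordLess_imp_ordLeq)
  qed
  have D'_le: "|D'| \<le>o omega1" using D'_omega1 by (simp add: ordIso_iff_ordLeq)
  define cyl where "cyl = (\<lambda>((a :: rat, b :: rat), F). X \<inter> {of_rat a<..<of_rat b} \<times> (- Some ` F))"
  define sli where "sli = (\<lambda>((a :: rat, b :: rat), d). X \<inter> {of_rat a<..<of_rat b} \<times> {Some d})"
  define \<B>1 where "\<B>1 = cyl ` (UNIV \<times> {F. finite F \<and> F \<subseteq> D'})"
  define \<B>2 where "\<B>2 = sli ` (UNIV \<times> D')"
  have Q: "|UNIV :: (rat \<times> rat) set| \<le>o omega1" by (intro ctbl) simp
  have "|(UNIV :: (rat \<times> rat) set) \<times> {F. finite F \<and> F \<subseteq> D'}| \<le>o omega1"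
    using card_of_finite_subsets_ordLeq[OF inf co D'_le] inf co Q
    by (intro card_of_Times_ordLeq_infinite_Field)
  then have B1: "|\<B>1| \<le>o omega1" unfolding \<B>1_def using card_of_image ordLeq_transitive by blast
  have "|(UNIV :: (rat \<times> rat) set) \<times> D'| \<le>o omega1"
    using inf co Q D'_le by (intro card_of_Times_ordLeq_infinite_Field)
  then have B2: "|\<B>2| \<le>o omega1" unfolding \<B>2_def using card_of_image ordLeq_transitive by blast
  show ?thesis
  proof (rule weight_eqI)
    show "|\<B>1 \<union> \<B>2| \<le>o omega1" using inf B1 B2 co by (rule card_of_Un_ordLeq_infinite_Field)
    show "base_of T (\<B>1 \<union> \<B>2)"
      unfolding base_of_iff
    proof (intro conjI allI impI ballI)
      show "openin T B" if "B \<in> \<B>1 \<union> \<B>2" for B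
        using that by (auto simp: \<B>1_def \<B>2_def cyl_def sli_def intro!: openin_T_slice openin_T_cylinder)
    next
      fix U x assume U: "openin T U" "x \<in> U"
      have x: "x \<in> X" using U openin_subset[OF U(1)] topspace_T by blast
      obtain t u where tu: "x = (t, u)" by fastforce
      show "\<exists>B\<in>\<B>1 \<union> \<B>2. x \<in> B \<and> B \<subseteq> U"
      proof (cases u)
        case None
        obtain G F where G: "open G" "t \<in> G" "finite F" "X \<inter> G \<times> (- Some ` F) \<subseteq> U"
          using U tu None unfolding openin_T by meson
        obtain a b :: rat where ab: "t \<in> {of_rat a<..<of_rat b}" "{of_rat a<..<of_rat b} \<subseteq> G"
          using rational_interval_in_open[OF G(1,2)] by meson
        \<comment> \<open>Levels outside \<open>D'\<close> carry no points of \<open>X\<close>, so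
          \<open>F\<close> may be cut down to \<open>D'\<close>; this keeps the number of cylinders
          independent of the size of \<open>D\<close>.\<close>
        have "cyl ((a, b), F \<inter> D') \<in> \<B>1" using G(3) by (auto simp: \<B>1_def)
        moreover have "x \<in> cyl ((a, b), F \<inter> D')" using x tu None ab(1) by (simp add: cyl_def)
        moreover have "cyl ((a, b), F \<inter> D') \<subseteq> X \<inter> G \<times> (- Some ` F)"
          using ab(2) by (auto simp: cyl_def attached_def)
        ultimately show ?thesis using G(4) by blast
      next
        case (Some d)
        obtain G where G: "open G" "t \<in> G" "X \<inter> G \<times> {Some d} \<subseteq> U"
          using U tu Some unfolding openin_T by meson
        obtain a b :: rat where ab: "t \<in> {of_rat a<..<of_rat b}" "{of_rat a<..<of_rat b} \<subseteq> G"
          using rational_interval_in_open[OF G(1,2)] by meson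
        have "sli ((a, b), d) \<in> \<B>2" using x tu Some by (auto simp: \<B>2_def)
        moreover have "x \<in> sli ((a, b), d)" using x tu Some ab(1) by (simp add: sli_def)
        moreover have "sli ((a, b), d) \<subseteq> X \<inter> G \<times> {Some d}" using ab(2) by (auto simp: sli_def)
        ultimately show ?thesis using G(3) by blast
      qed
    qed
  next
    fix \<A> assume A: "base_of T \<A>"
    have "\<forall>d\<in>D'. \<exists>B. B \<in> \<A> \<and> B \<noteq> {} \<and> B \<subseteq> UNIV \<times> {Some d}"
    proof
      fix d assume d: "d \<in> D'"
      then obtain t where "t \<in> K d" using nonempty by blast
      then have "(t, Some d) \<in> X \<inter> UNIV \<times> {Some d}" using d by simp
      moreover have "openin T (X \<inter> UNIV \<times> {Some d})" by (rule openin_T_slice) simp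
      ultimately obtain B where "B \<in> \<A>" "(t, Some d) \<in> B" "B \<subseteq> X \<inter> UNIV \<times> {Some d}"
        using A unfolding base_of_iff by meson
      then show "\<exists>B. B \<in> \<A> \<and> B \<noteq> {} \<and> B \<subseteq> UNIV \<times> {Some d}" by blast
    qed
    from bchoice[OF this] obtain f where
      f: "\<forall>d\<in>D'. f d \<in> \<A> \<and> f d \<noteq> {} \<and> f d \<subseteq> UNIV \<times> {Some d}" by blast
    have "inj_on f D'"
    proof (rule inj_onI)
      fix c d assume cd: "c \<in> D'" "d \<in> D'" "f c = f d"
      then obtain x where "x \<in> f c" using f by blast
      then have "x \<in> UNIV \<times> {Some c}" "x \<in> UNIV \<times> {Some d}" using f cd by blast+
      then show "c = d" by auto
    qed
    moreover have "f ` D' \<subseteq> \<A>" using f by blast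
    ultimately have "|D'| \<le>o |\<A>|" using card_of_ordLeq by blast
    then show "omega1 \<le>o |\<A>|" using D'_omega1 by (meson ordIso_ordLeq_trans ordIso_symmetric)
  qed
qed

end

section \<open>Failure of supercompactness\<close>

lemma meager_frontier:
  assumes "open V"
  shows "meager (frontier V)"
proof (rule nowhere_dense_imp_meager)
  have "interior (frontier V) = {}"
  proof (rule ccontr)
    assume "interior (frontier V) \<noteq> {}"
    then obtain x where x: "x \<in> interior (frontier V)" by blast
    then have "x \<in> closure V" using interior_subset frontier_subset_closed[of "closure V"]
      by (auto simp: frontier_def)
    then have "interior (frontier V) \<inter> V \<noteq> {}"
      using x open_Int_closure_eq_empty[OF open_interior, of "frontier V" V] by blast
    then show False using interior_subset[of "frontier V"] assms by (auto simp: frontier_def interior_open)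
  qed
  then show "nowhere_dense (frontier V)"
    by (simp add: nowhere_dense_def closure_closed)
qed

text \<open>The set on the right is the complement of a finite union of finite intersections of
  members of \<open>\<B>\<close>. Distributivity writes it as a finite union of intersections of
  complements.\<close>

lemma finite_union_of_complements:
  assumes "finite \<E>" "\<forall>E\<in>\<E>. finite E \<and> E \<subseteq> \<B>"
  shows "\<exists>\<F>. finite \<F> \<and> \<F> \<subseteq> (\<lambda>E. X - \<Union>E) ` Pow \<B> \<and> \<Union>\<F> = {x \<in> X. \<forall>E\<in>\<E>. \<exists>B\<in>E. x \<notin> B}"
  using assms
proof (induction \<E> rule: finite_induct)
  case empty
  have "\<Union>{X} = {x \<in> X. \<forall>E\<in>{}. \<exists>B\<in>E. x \<notin> B}" by simp
  moreover have "X \<in> (\<lambda>E. X - \<Union>E) ` Pow \<B>" by (rule image_eqI[of _ _ "{}"]) simp_all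
  ultimately show ?case by (intro exI[of _ "{X}"]) simp
next
  case (insert E \<E>)
  have "\<exists>\<F>. finite \<F> \<and> \<F> \<subseteq> (\<lambda>E. X - \<Union>E) ` Pow \<B> \<and> \<Union>\<F> = {x \<in> X. \<forall>E\<in>\<E>. \<exists>B\<in>E. x \<notin> B}"
    by (rule insert.IH) (use insert.prems in simp)
  then obtain \<F> where F: "finite \<F>" "\<F> \<subseteq> (\<lambda>E. X - \<Union>E) ` Pow \<B>"
    "\<Union>\<F> = {x \<in> X. \<forall>E\<in>\<E>. \<exists>B\<in>E. x \<notin> B}" by (elim exE conjE) (rule that)
  have E: "finite E" "E \<subseteq> \<B>" using insert.prems by simp_all
  define \<F>' where "\<F>' = (\<lambda>(B, F). F - B) ` (E \<times> \<F>)"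
  have "finite \<F>'" using F(1) E(1) by (simp add: \<F>'_def)
  moreover have "\<F>' \<subseteq> (\<lambda>E. X - \<Union>E) ` Pow \<B>"
  proof
    fix G assume "G \<in> \<F>'"
    then obtain B F' where BF: "B \<in> E" "F' \<in> \<F>" "G = F' - B" by (auto simp: \<F>'_def)
    then obtain E' where E': "E' \<subseteq> \<B>" "F' = X - \<Union>E'" using F(2) by blast
    have "G = X - \<Union>(insert B E')" unfolding BF(3) E'(2) by blast
    moreover have "insert B E' \<in> Pow \<B>" using E(2) BF(1) E'(1) by blast
    ultimately show "G \<in> (\<lambda>E. X - \<Union>E) ` Pow \<B>" by (rule image_eqI)
  qed
  moreover have "\<Union>\<F>' = {x \<in> X. \<forall>E'\<in>insert E \<E>. \<exists>B\<in>E'. x \<notin> B}"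
  proof -
    have "\<Union>\<F>' = {x \<in> \<Union>\<F>. \<exists>B\<in>E. x \<notin> B}" by (auto simp: \<F>'_def)
    then show ?thesis unfolding F(3) by auto
  qed
  ultimately show ?case by (intro exI[of _ \<F>']) simp
qed

lemma subset_pair_if_card_le_2:
  assumes "finite \<F>" "card \<F> \<le> 2" "\<F> \<noteq> {}"
  shows "\<exists>u v. \<F> = {u, v}"
proof -
  have "card \<F> = 1 \<or> card \<F> = 2" using assms by (metis One_nat_def Suc_1 card_0_eq le_Suc_eq le_zero_eq)
  then show ?thesis
  proof
    assume "card \<F> = 1"
    then obtain u where "\<F> = {u}" by (rule card_1_singletonE)
    then show ?thesis by blast
  next
    assume "card \<F> = 2"
    then show ?thesis by (meson card_2_iff)
  qed
qed

text \<open>The family consists of all intersections of complements of subbasic sets. Three members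
  without a common point give a subbasic cover, and a subcover by two sets shows that some pair is
  already disjoint. Compactness provides the finite unions between \<open>P\<close> and
  \<open>W\<close>.\<close>

lemma supercompact_closed_family:
  assumes sc: "supercompact_space X" and comp: "compact_space X"
  shows "\<exists>\<G>. (\<forall>G\<in>\<G>. closedin X G) \<and>
    (\<forall>A\<in>\<G>. \<forall>B\<in>\<G>. \<forall>C\<in>\<G>. A \<inter> B \<noteq> {} \<longrightarrow> A \<inter> C \<noteq> {} \<longrightarrow> B \<inter> C \<noteq> {} \<longrightarrow> A \<inter> B \<inter> C \<noteq> {}) \<and>
    (\<forall>P W. closedin X P \<longrightarrow> openin X W \<longrightarrow> P \<subseteq> W \<longrightarrow>
      (\<exists>\<F>. finite \<F> \<and> \<F> \<subseteq> \<G> \<and> P \<subseteq> \<Union>\<F> \<and> \<Union>\<F> \<subseteq> W))"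
proof -
  obtain \<B> where sb: "subbase_of X \<B>" and binary: "\<And>\<C>. \<C> \<subseteq> \<B> \<Longrightarrow> \<Union>\<C> = topspace X \<Longrightarrow>
      \<exists>\<F>. \<F> \<subseteq> \<C> \<and> finite \<F> \<and> card \<F> \<le> 2 \<and> \<Union>\<F> = topspace X"
    using sc unfolding supercompact_space_def by meson
  have op: "openin X U" if "U \<in> \<B>" for U using sb that unfolding subbase_of_def by blast
  have base: "\<exists>E. finite E \<and> E \<subseteq> \<B> \<and> y \<in> topspace X \<inter> \<Inter>E \<and> topspace X \<inter> \<Inter>E \<subseteq> U"
    if U: "openin X U" "y \<in> U" for U y
  proof -
    have eq: "openin X = arbitrary union_of (finite intersection_of (\<lambda>U. U \<in> \<B>) relative_to topspace X)"
      using sb by (simp add: subbase_of_def)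
    have "(arbitrary union_of (finite intersection_of (\<lambda>U. U \<in> \<B>) relative_to topspace X)) U"
      using U(1) unfolding eq .
    then obtain V where V: "(finite intersection_of (\<lambda>U. U \<in> \<B>) relative_to topspace X) V" "y \<in> V" "V \<subseteq> U"
      using U(2) unfolding arbitrary_union_of_alt by blast
    then obtain E where "finite E" "E \<subseteq> Collect (\<lambda>U. U \<in> \<B>)" "topspace X \<inter> \<Inter>E = V"
      unfolding relative_to_def intersection_of_def by blast
    then show ?thesis using V by (intro exI[of _ E]) auto
  qed
  define \<G> where "\<G> = (\<lambda>E. topspace X - \<Union>E) ` Pow \<B>"
  have closed: "closedin X G" if "G \<in> \<G>" for G
    using that op unfolding \<G>_def by (auto intro!: closedin_diff openin_Union)
  have binary': "A \<inter> B \<inter> C \<noteq> {}" if ABC: "A \<in> \<G>" "B \<in> \<G>" "C \<in> \<G>" "A \<inter> B \<noteq> {}" "A \<inter> C \<noteq> {}" "B \<inter> C \<noteq> {}" for A B C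
  proof
    assume empty: "A \<inter> B \<inter> C = {}"
    obtain E1 where E1: "E1 \<subseteq> \<B>" "A = topspace X - \<Union>E1" using ABC(1) by (auto simp: \<G>_def)
    obtain E2 where E2: "E2 \<subseteq> \<B>" "B = topspace X - \<Union>E2" using ABC(2) by (auto simp: \<G>_def)
    obtain E3 where E3: "E3 \<subseteq> \<B>" "C = topspace X - \<Union>E3" using ABC(3) by (auto simp: \<G>_def)
    have sub: "E1 \<union> E2 \<union> E3 \<subseteq> \<B>" using E1 E2 E3 by blast
    have "\<Union>(E1 \<union> E2 \<union> E3) \<subseteq> topspace X" using sub op openin_subset by blast
    moreover have "topspace X \<subseteq> \<Union>(E1 \<union> E2 \<union> E3)" using empty E1(2) E2(2) E3(2) by blast
    ultimately have "\<Union>(E1 \<union> E2 \<union> E3) = topspace X" by blast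
    then obtain \<F> where F: "\<F> \<subseteq> E1 \<union> E2 \<union> E3" "finite \<F>" "card \<F> \<le> 2" "\<Union>\<F> = topspace X"
      using binary[OF sub] by blast
    obtain p where p: "p \<in> topspace X" "p \<notin> \<Union>E1" "p \<notin> \<Union>E2" using ABC(4) E1(2) E2(2) by blast
    obtain q where q: "q \<in> topspace X" "q \<notin> \<Union>E1" "q \<notin> \<Union>E3" using ABC(5) E1(2) E3(2) by blast
    obtain r where r: "r \<in> topspace X" "r \<notin> \<Union>E2" "r \<notin> \<Union>E3" using ABC(6) E2(2) E3(2) by blast
    have "\<F> \<noteq> {}" using F(4) p(1) by auto
    then obtain u v where uv: "\<F> = {u, v}" using subset_pair_if_card_le_2[OF F(2,3)] by blast
    have "p \<in> u \<union> v" "q \<in> u \<union> v" "r \<in> u \<union> v" using F(4) p(1) q(1) r(1) uv by auto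
    \<comment> \<open>Each of \<open>E1\<close>, \<open>E2\<close>, \<open>E3\<close> covers at most
      one of the points \<open>p\<close>, \<open>q\<close>, \<open>r\<close>, so the two sets
      \<open>u\<close> and \<open>v\<close> cannot cover all three.\<close>
    moreover have "(p \<in> w \<longrightarrow> q \<notin> w \<and> r \<notin> w) \<and> (q \<in> w \<longrightarrow> r \<notin> w)" if "w \<in> \<F>" for w
    proof -
      have "w \<in> E1 \<or> w \<in> E2 \<or> w \<in> E3" using that F(1) by blast
      then show ?thesis using p(2,3) q(2,3) r(2,3) by (metis UnionI)
    qed
    then have "(p \<in> u \<longrightarrow> q \<notin> u \<and> r \<notin> u) \<and> (q \<in> u \<longrightarrow> r \<notin> u)"
      "(p \<in> v \<longrightarrow> q \<notin> v \<and> r \<notin> v) \<and> (q \<in> v \<longrightarrow> r \<notin> v)" unfolding uv by simp_all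
    ultimately show False by blast
  qed
  have between: "\<exists>\<F>. finite \<F> \<and> \<F> \<subseteq> \<G> \<and> P \<subseteq> \<Union>\<F> \<and> \<Union>\<F> \<subseteq> W"
    if PW: "closedin X P" "openin X W" "P \<subseteq> W" for P W
  proof -
    \<comment> \<open>Basic open sets missing \<open>P\<close> cover the compact complement of
      \<open>W\<close>. The complement of a finite subcover contains \<open>P\<close>, lies in
      \<open>W\<close> and splits into members of \<open>\<G>\<close>.\<close>
    define \<E>\<^sub>0 where "\<E>\<^sub>0 = {E. finite E \<and> E \<subseteq> \<B> \<and> topspace X \<inter> \<Inter>E \<subseteq> topspace X - P}"
    define U where "U E = topspace X \<inter> \<Inter>E" for E
    have "compactin X (topspace X - W)" using PW(2) comp by (intro closedin_compact_space) blast+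
    moreover have "\<forall>V\<in>U ` \<E>\<^sub>0. openin X V"
    proof
      fix V assume "V \<in> U ` \<E>\<^sub>0"
      then obtain E where E: "finite E" "E \<subseteq> \<B>" "V = topspace X \<inter> \<Inter>E" by (auto simp: \<E>\<^sub>0_def U_def)
      then show "openin X V" using op by (cases "E = {}") (auto intro!: openin_Int openin_Inter)
    qed
    moreover have "topspace X - W \<subseteq> \<Union>(U ` \<E>\<^sub>0)"
    proof
      fix y assume "y \<in> topspace X - W"
      then have "y \<in> topspace X - P" using PW(3) by blast
      moreover have "openin X (topspace X - P)" using PW(1) by blast
      ultimately obtain E where "finite E" "E \<subseteq> \<B>" "y \<in> U E" "topspace X \<inter> \<Inter>E \<subseteq> topspace X - P"
        unfolding U_def using base by meson
      then show "y \<in> \<Union>(U ` \<E>\<^sub>0)" unfolding \<E>\<^sub>0_def by blast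
    qed
    ultimately obtain \<V> where V: "finite \<V>" "\<V> \<subseteq> U ` \<E>\<^sub>0" "topspace X - W \<subseteq> \<Union>\<V>"
      unfolding compactin_def by meson
    obtain \<E> where \<E>: "finite \<E>" "\<E> \<subseteq> \<E>\<^sub>0" "\<V> = U ` \<E>" using finite_subset_image[OF V(1,2)] by blast
    have "\<forall>E\<in>\<E>. finite E \<and> E \<subseteq> \<B>" using \<E>(2) by (auto simp: \<E>\<^sub>0_def)
    from finite_union_of_complements[OF \<E>(1) this, of "topspace X", folded \<G>_def]
    obtain \<F> where F: "finite \<F>" "\<F> \<subseteq> \<G>" "\<Union>\<F> = {x \<in> topspace X. \<forall>E\<in>\<E>. \<exists>B\<in>E. x \<notin> B}"
      by (elim exE conjE) (rule that)
    have "P \<subseteq> \<Union>\<F>"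
    proof
      fix x assume x: "x \<in> P"
      then have xX: "x \<in> topspace X" using closedin_subset[OF PW(1)] by blast
      have "\<exists>B\<in>E. x \<notin> B" if "E \<in> \<E>" for E
      proof -
        have "topspace X \<inter> \<Inter>E \<subseteq> topspace X - P" using that \<E>(2) by (auto simp: \<E>\<^sub>0_def)
        then show ?thesis using x xX by blast
      qed
      then show "x \<in> \<Union>\<F>" unfolding F(3) using xX by blast
    qed
    moreover have "\<Union>\<F> \<subseteq> W"
    proof
      fix x assume x: "x \<in> \<Union>\<F>"
      show "x \<in> W"
      proof (rule ccontr)
        assume "x \<notin> W"
        then have "x \<in> \<Union>(U ` \<E>)" using x V(3) \<E>(3) unfolding F(3) by blast
        then show False using x unfolding F(3) U_def by blast
      qed
    qed
    ultimately show ?thesis using F(1,2) by (intro exI[of _ \<F>] conjI)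
  qed
  show ?thesis
  proof (intro exI[of _ \<G>] conjI)
    show "\<forall>G\<in>\<G>. closedin X G" using closed by simp
    show "\<forall>A\<in>\<G>. \<forall>B\<in>\<G>. \<forall>C\<in>\<G>. A \<inter> B \<noteq> {} \<longrightarrow> A \<inter> C \<noteq> {} \<longrightarrow> B \<inter> C \<noteq> {} \<longrightarrow> A \<inter> B \<inter> C \<noteq> {}"
      by (intro ballI impI) (rule binary')
    show "\<forall>P W. closedin X P \<longrightarrow> openin X W \<longrightarrow> P \<subseteq> W \<longrightarrow>
        (\<exists>\<F>. finite \<F> \<and> \<F> \<subseteq> \<G> \<and> P \<subseteq> \<Union>\<F> \<and> \<Union>\<F> \<subseteq> W)"
      by (intro allI impI) (rule between)
  qed
qed

section \<open>Binary closed families and generic levels\<close>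

context attached_sets
begin

lemma compact_T: "compact_space T"
  using closedin_compact_space[OF compact_unit_times_discrete closedin_X]
  by (simp add: compact_space_subtopology)

lemma closed_level:
  assumes "closedin T S"
  shows "closed {t. (t, None) \<in> S}"
proof -
  have "open (- {t. (t, None) \<in> S})"
  proof (subst open_subopen, rule ballI)
    fix t assume t: "t \<in> - {t. (t, None) \<in> S}"
    show "\<exists>G. open G \<and> t \<in> G \<and> G \<subseteq> - {t. (t, None) \<in> S}"
    proof (cases "t \<in> {0..1}")
      case True
      have "openin T (X - S)" using assms unfolding closedin_def topspace_T by simp
      moreover have "(t, None) \<in> X - S" using True t by simp
      ultimately obtain G F where G: "open G" "t \<in> G" "X \<inter> G \<times> (- Some ` F) \<subseteq> X - S"
        unfolding openin_T by meson
      have "(s, None) \<notin> S" if "s \<in> G" for s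
      proof
        assume s: "(s, None) \<in> S"
        then have "(s, None) \<in> X" using closedin_subset[OF assms] topspace_T by blast
        then have "(s, None) \<in> X \<inter> G \<times> (- Some ` F)" using that by simp
        then show False using G(3) s by blast
      qed
      then show ?thesis using G(1,2) by (intro exI[of _ G]) auto
    next
      case False
      have "(s, None) \<notin> S" if "s \<in> - {0..1}" for s
      proof
        assume "(s, None) \<in> S"
        then have "(s, None) \<in> X" using closedin_subset[OF assms] topspace_T by blast
        then show False using that by simp
      qed
      then have "- {0..1} \<subseteq> - {t. (t, None) \<in> S}" by blast
      moreover have "open (- {0..1::real})" by (intro open_Compl closed_atLeastAtMost)
      moreover have "t \<in> - {0..1}" using False by simp
      ultimately show ?thesis by (intro exI[of _ "- {0..1}"] conjI)
    qed
  qed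
  then show ?thesis by (simp add: closed_def)
qed

text \<open>A point \<open>(t, None)\<close> outside \<open>S\<close> has a neighbourhood that
  avoids \<open>S\<close>: a rational interval times the complement of finitely many levels. An
  exceptional \<open>d\<close> witnessed by \<open>t\<close> is one of these levels. Choosing one
  finite set of levels per rational interval captures all exceptional \<open>d\<close>.\<close>

lemma countable_exceptional_slices:
  assumes S: "closedin T S"
  shows "countable {d. \<exists>t. (t, Some d) \<in> S \<and> (t, None) \<notin> S}"
proof -
  have sub: "S \<subseteq> X" using closedin_subset[OF S] topspace_T by simp
  define I where "I = (\<lambda>(a :: rat, b :: rat). {of_rat a<..<of_rat b :: real})"
  define R where "R ab F \<longleftrightarrow> finite F \<and> S \<inter> I ab \<times> (- Some ` F) = {}" for ab F
  define f where "f ab = (if \<exists>F. R ab F then SOME F. R ab F else {})" for ab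
  have f: "R ab (f ab)" if "R ab F" for ab F
    unfolding f_def using someI[of "R ab" F] that by auto
  have fin: "finite (f ab)" for ab
  proof (cases "\<exists>F. R ab F")
    case True
    then show ?thesis using f unfolding R_def by blast
  qed (simp add: f_def)
  have "{d. \<exists>t. (t, Some d) \<in> S \<and> (t, None) \<notin> S} \<subseteq> (\<Union>ab. f ab)"
  proof
    fix d assume "d \<in> {d. \<exists>t. (t, Some d) \<in> S \<and> (t, None) \<notin> S}"
    then obtain t where t: "(t, Some d) \<in> S" "(t, None) \<notin> S" by blast
    have "(t, Some d) \<in> X" using t(1) sub by blast
    then have "d \<in> D'" "t \<in> K d" by simp_all
    then have "t \<in> {0..1}" using K_subset by blast
    then have "(t, None) \<in> X - S" using t(2) by simp
    moreover have "openin T (X - S)" using S unfolding closedin_def topspace_T by simp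
    ultimately obtain G F where G: "open G" "t \<in> G" "finite F" "X \<inter> G \<times> (- Some ` F) \<subseteq> X - S"
      unfolding openin_T by meson
    obtain a b :: rat where ab: "t \<in> {of_rat a<..<of_rat b}" "{of_rat a<..<of_rat b} \<subseteq> G"
      using rational_interval_in_open[OF G(1,2)] by meson
    have "S \<inter> I (a, b) \<times> (- Some ` F) \<subseteq> X \<inter> G \<times> (- Some ` F)" using ab(2) sub by (auto simp: I_def)
    then have "R (a, b) F" using G(3,4) unfolding R_def by blast
    then have "R (a, b) (f (a, b))" by (rule f)
    then have "d \<in> f (a, b)" using t(1) ab(1) by (auto simp: R_def I_def)
    then show "d \<in> (\<Union>ab. f ab)" by blast
  qed
  moreover have "countable (\<Union>ab. f ab)" using fin by (intro countable_UN) (auto intro: countable_finite)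
  ultimately show ?thesis by (rule countable_subset)
qed

lemma not_supercompact_T:
  assumes \<zeta>: "\<And>d. d \<in> D' \<Longrightarrow> \<zeta> d \<in> {0<..<1}"
    and K: "\<And>d. d \<in> D' \<Longrightarrow> K d = coded (\<zeta> d)"
    and Luzin: "\<And>M. meager M \<Longrightarrow> countable {d \<in> D'. \<zeta> d \<in> M}"
    and unc: "\<not> countable D'"
  shows "\<not> supercompact_space T"
proof
  assume "supercompact_space T"
  from supercompact_closed_family[OF this compact_T] obtain \<G> where closed_\<G>: "\<forall>G\<in>\<G>. closedin T G"
    and lnk: "\<forall>A\<in>\<G>. \<forall>B\<in>\<G>. \<forall>C\<in>\<G>. A \<inter> B \<noteq> {} \<longrightarrow> A \<inter> C \<noteq> {} \<longrightarrow> B \<inter> C \<noteq> {} \<longrightarrow> A \<inter> B \<inter> C \<noteq> {}"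
    and btw: "\<forall>P W. closedin T P \<longrightarrow> openin T W \<longrightarrow> P \<subseteq> W \<longrightarrow>
      (\<exists>\<F>. finite \<F> \<and> \<F> \<subseteq> \<G> \<and> P \<subseteq> \<Union>\<F> \<and> \<Union>\<F> \<subseteq> W)"
    by (elim exE conjE) (rule that)
  define \<eta> where "\<eta> k = 3 / real (Suc k)" for k
  have strip: "openin T (X \<inter> G \<times> UNIV)" if "open G" for G
    using openin_T_cylinder[OF that, of "{}"] by simp
  have "\<exists>\<F>. finite \<F> \<and> \<F> \<subseteq> \<G> \<and> X \<subseteq> \<Union>\<F> \<and> (\<forall>S\<in>\<F>. \<forall>x\<in>S. \<forall>y\<in>S. dist (fst x) (fst y) < \<eta> k)" for k
  proof -
    define n where "n = real (Suc k)"
    have n: "0 < n" by (simp add: n_def)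
    \<comment> \<open>Closed strips of width \<open>1 / n\<close> inside open strips of width
      \<open>3 / n\<close>: members of \<open>\<G>\<close> squeezed in between cover
      \<open>X\<close> with mesh below \<open>\<eta> k\<close>.\<close>
    define P where "P i = X \<inter> {real i / n..(real i + 1) / n} \<times> UNIV" for i :: nat
    define W where "W i = X \<inter> {(real i - 1) / n<..<(real i + 2) / n} \<times> UNIV" for i :: nat
    have "closedin T (P i)" for i
    proof -
      have "X - P i = X \<inter> (- {real i / n..(real i + 1) / n}) \<times> UNIV" by (auto simp: P_def)
      then show ?thesis unfolding closedin_def topspace_T
        by (simp add: P_def strip open_Compl)
    qed
    moreover have "openin T (W i)" for i unfolding W_def by (intro strip) simp
    moreover have "P i \<subseteq> W i" for i
    proof -
      have "(real i - 1) / n < real i / n" "(real i + 1) / n < (real i + 2) / n"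
        using n by (simp_all add: divide_strict_right_mono)
      then show ?thesis unfolding P_def W_def by (intro Int_mono Sigma_mono) auto
    qed
    ultimately have "\<forall>i. \<exists>\<F>. finite \<F> \<and> \<F> \<subseteq> \<G> \<and> P i \<subseteq> \<Union>\<F> \<and> \<Union>\<F> \<subseteq> W i"
      using btw by simp
    from choice[OF this] obtain \<F> where
      "\<forall>i. finite (\<F> i) \<and> \<F> i \<subseteq> \<G> \<and> P i \<subseteq> \<Union>(\<F> i) \<and> \<Union>(\<F> i) \<subseteq> W i"
      by (elim exE) (rule that)
    then have F: "finite (\<F> i)" "\<F> i \<subseteq> \<G>" "P i \<subseteq> \<Union>(\<F> i)" "\<Union>(\<F> i) \<subseteq> W i" for i by simp_all
    have "X \<subseteq> \<Union>(\<Union>i\<le>Suc k. \<F> i)"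
    proof
      fix x assume x: "x \<in> X"
      obtain t u where tu: "x = (t, u)" by fastforce
      have t: "t \<in> {0..1}"
        using x X_subset unfolding tu by auto
      define i where "i = nat \<lfloor>t * n\<rfloor>"
      have "0 \<le> t * n" using t n by simp
      then have "real i \<le> t * n" "t * n < real i + 1" unfolding i_def by linarith+
      then have "t \<in> {real i / n..(real i + 1) / n}" using n by (simp add: field_simps)
      then have "x \<in> P i" using x tu by (simp add: P_def)
      moreover have "t * n \<le> 1 * n" using t n by (intro mult_right_mono) auto
      then have "real i \<le> n" using \<open>real i \<le> t * n\<close> by linarith
      then have "i \<le> Suc k" by (simp add: n_def)
      ultimately show "x \<in> \<Union>(\<Union>i\<le>Suc k. \<F> i)" using F(3)[of i] by blast
    qed
    moreover have "dist (fst x) (fst y) < \<eta> k" if S: "S \<in> (\<Union>i\<le>Suc k. \<F> i)" "x \<in> S" "y \<in> S" for S x y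
    proof -
      obtain i where "S \<in> \<F> i" using S(1) by blast
      then have "x \<in> W i" "y \<in> W i" using F(4)[of i] S by blast+
      then have "dist (fst x) (fst y) < (real i + 2) / n - (real i - 1) / n"
        by (auto simp: W_def dist_real_def)
      also have "\<dots> = 3 / n" using n by (simp add: field_simps)
      also have "\<dots> = \<eta> k" by (simp add: \<eta>_def n_def)
      finally show ?thesis .
    qed
    moreover have "finite (\<Union>i\<le>Suc k. \<F> i)" using F(1) by simp
    moreover have "(\<Union>i\<le>Suc k. \<F> i) \<subseteq> \<G>" using F(2) by blast
    ultimately show ?thesis by (intro exI[of _ "\<Union>i\<le>Suc k. \<F> i"] conjI ballI)
  qed
  then have "\<forall>k. \<exists>\<F>. finite \<F> \<and> \<F> \<subseteq> \<G> \<and> X \<subseteq> \<Union>\<F> \<and> (\<forall>S\<in>\<F>. \<forall>x\<in>S. \<forall>y\<in>S. dist (fst x) (fst y) < \<eta> k)" by simp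
  from choice[OF this] obtain \<S> where \<S>0: "\<forall>k. finite (\<S> k) \<and> \<S> k \<subseteq> \<G> \<and> X \<subseteq> \<Union>(\<S> k) \<and>
    (\<forall>S\<in>\<S> k. \<forall>x\<in>S. \<forall>y\<in>S. dist (fst x) (fst y) < \<eta> k)" by blast
  have \<S>: "finite (\<S> k)" "\<S> k \<subseteq> \<G>" "X \<subseteq> \<Union>(\<S> k)"
    "\<And>S x y. S \<in> \<S> k \<Longrightarrow> x \<in> S \<Longrightarrow> y \<in> S \<Longrightarrow> dist (fst x) (fst y) < \<eta> k" for k
    using spec[OF \<S>0, of k] by simp_all
  define lev where "lev S = {t. (t, None) \<in> S}" for S :: "(real \<times> 'a option) set"
  interpret shrinking_families "\<lambda>k. lev ` \<S> k" \<eta>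
  proof
    show "finite (lev ` \<S> k)" for k using \<S>(1) by simp
    show "closed A" if "A \<in> lev ` \<S> k" for k A
      using that closed_\<G> \<S>(2) closed_level unfolding lev_def by blast
    show "dist s t < \<eta> k" if A: "A \<in> lev ` \<S> k" "s \<in> A" "t \<in> A" for k A s t
    proof -
      obtain S where S: "S \<in> \<S> k" "A = lev S" using A(1) by blast
      then have "(s, None) \<in> S" "(t, None) \<in> S" using A(2,3) by (simp_all add: lev_def)
      then show ?thesis using \<S>(4)[OF S(1)] by fastforce
    qed
    show "\<eta> \<longlonglongrightarrow> 0" unfolding \<eta>_def by (rule LIMSEQ_Suc[OF lim_const_over_n])
  qed
  define exc where "exc S = {d. \<exists>t. (t, Some d) \<in> S \<and> (t, None) \<notin> S}" for S :: "(real \<times> 'a option) set"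
  have "countable (exc S)" if "S \<in> \<S> k" for S k
  proof -
    have "closedin T S" using subsetD[OF \<S>(2) that] by (rule bspec[OF closed_\<G>])
    then show ?thesis unfolding exc_def by (rule countable_exceptional_slices)
  qed
  then have "countable (\<Union>k. \<Union>S\<in>\<S> k. exc S)"
    using \<S>(1) by (intro countable_UN) (auto intro: countable_finite)
  moreover have "countable {d \<in> D'. \<zeta> d \<in> {z \<in> {0<..<1}. \<exists>\<epsilon>>0. \<not> trapped \<epsilon> z}}"
    using meager_untrapped by (rule Luzin)
  \<comment> \<open>The bad levels are countably many: those where a member of some
    \<open>\<S> k\<close> is not contained in its slice at \<infinity>, and those where
    \<open>\<zeta> d\<close> is not trapped for some \<open>\<epsilon>\<close>.\<close>
  ultimately have "\<not> D' \<subseteq> (\<Union>k. \<Union>S\<in>\<S> k. exc S) \<union> {d \<in> D'. \<zeta> d \<in> {z \<in> {0<..<1}. \<exists>\<epsilon>>0. \<not> trapped \<epsilon> z}}"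
    using unc by (meson countable_Un countable_subset)
  then obtain d where d: "d \<in> D'" "d \<notin> (\<Union>k. \<Union>S\<in>\<S> k. exc S)"
    "d \<notin> {d \<in> D'. \<zeta> d \<in> {z \<in> {0<..<1}. \<exists>\<epsilon>>0. \<not> trapped \<epsilon> z}}"
    unfolding subset_iff Un_iff by meson
  have trap: "trapped \<epsilon> (\<zeta> d)" if "0 < \<epsilon>" for \<epsilon> using d(1,3) \<zeta>[OF d(1)] that by blast
  have down: "t \<in> lev S" if "S \<in> \<S> k" "(t, Some d) \<in> S" for t S k
    using d(2) that by (auto simp: exc_def lev_def)
  define Z where "Z = X \<inter> UNIV \<times> {Some d}"
  have "openin T Z" unfolding Z_def by (rule openin_T_slice) simp
  moreover have "closedin T Z"
  proof -
    have "X - Z = X \<inter> UNIV \<times> (- Some ` {d})" by (auto simp: Z_def)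
    then show ?thesis unfolding closedin_def topspace_T
      using openin_T_cylinder[of UNIV "{d}"] by (simp add: Z_def)
  qed
  \<comment> \<open>Being clopen, \<open>Z\<close> can be used both as \<open>P\<close> and as
    \<open>W\<close> in \<open>btw\<close>, so finitely many members of \<open>\<G>\<close> have
    union exactly \<open>Z\<close>.\<close>
  ultimately obtain \<A> where A: "finite \<A>" "\<A> \<subseteq> \<G>" "\<Union>\<A> = Z"
    using btw by (meson order_refl subset_antisym)
  have "\<forall>\<^sub>F t in nhds (\<zeta> d). (t, Some d) \<in> B \<longrightarrow> (\<zeta> d, Some d) \<in> B" if B: "B \<in> \<A>" for B
  proof (cases "(\<zeta> d, Some d) \<in> B")
    case False
    have "closedin T B" using subsetD[OF A(2) B] by (rule bspec[OF closed_\<G>])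
    then have "openin T (X - B)" unfolding closedin_def topspace_T by simp
    moreover have "(\<zeta> d, Some d) \<in> X - B" using False d(1) K by simp
    ultimately obtain G where G: "open G" "\<zeta> d \<in> G" "X \<inter> G \<times> {Some d} \<subseteq> X - B"
      unfolding openin_T by meson
    have "(t, Some d) \<notin> B" if "t \<in> G" for t
    proof
      assume t: "(t, Some d) \<in> B"
      then have "(t, Some d) \<in> X" using A(3) B unfolding Z_def by blast
      then have "(t, Some d) \<in> X \<inter> G \<times> {Some d}" using that by simp
      then show False using G(3) t by blast
    qed
    then show ?thesis using G(1,2) eventually_nhds by blast
  qed simp
  then have "\<forall>\<^sub>F t in nhds (\<zeta> d). \<forall>B\<in>\<A>. (t, Some d) \<in> B \<longrightarrow> (\<zeta> d, Some d) \<in> B"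
    using A(1) by (intro eventually_ball_finite) simp_all
  then obtain \<epsilon> where \<epsilon>: "0 < \<epsilon>"
    "\<And>t B. dist t (\<zeta> d) < \<epsilon> \<Longrightarrow> B \<in> \<A> \<Longrightarrow> (t, Some d) \<in> B \<Longrightarrow> (\<zeta> d, Some d) \<in> B"
    unfolding eventually_nhds_metric by meson
  obtain k where k: "\<forall>S\<in>lev ` \<S> k. \<zeta> d \<in> S \<longrightarrow>
      (\<exists>v\<in>coded (\<zeta> d). \<exists>b\<in>S. \<exists>l. dist v (\<zeta> d) < \<epsilon> \<and> (\<forall>S'\<in>lev ` \<S> l. v \<in> S' \<longrightarrow> b \<in> S') \<and>
        (\<forall>w\<in>coded (\<zeta> d) \<inter> S. \<eta> l \<le> dist w b))"
    using trap[OF \<epsilon>(1)] unfolding trapped_def ..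
  have xX: "(\<zeta> d, Some d) \<in> X" using d(1) K by simp
  then obtain S where S: "S \<in> \<S> k" "(\<zeta> d, Some d) \<in> S" using \<S>(3) by blast
  obtain v b l where v: "v \<in> coded (\<zeta> d)" "b \<in> lev S" "dist v (\<zeta> d) < \<epsilon>"
    "\<forall>S'\<in>lev ` \<S> l. v \<in> S' \<longrightarrow> b \<in> S'" "\<forall>w\<in>coded (\<zeta> d) \<inter> lev S. \<eta> l \<le> dist w b"
    using mp[OF bspec[OF k imageI[OF S(1)]] down[OF S]] by (elim bexE exE conjE) (rule that)
  have vX: "(v, Some d) \<in> X" using v(1) d(1) K by simp
  then obtain B where B: "B \<in> \<A>" "(v, Some d) \<in> B" using A(3) unfolding Z_def by blast
  have xB: "(\<zeta> d, Some d) \<in> B" using \<epsilon>(2)[OF v(3) B] .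
  obtain S' where S': "S' \<in> \<S> l" "(v, Some d) \<in> S'" using vX \<S>(3) by blast
  have bS': "b \<in> lev S'" using v(4) S'(1) down[OF S'] by blast
  have "S \<in> \<G>" "S' \<in> \<G>" "B \<in> \<G>" using S(1) S'(1) B(1) \<S>(2) A(2) by blast+
  moreover have "S \<inter> S' \<noteq> {}" using v(2) bS' by (auto simp: lev_def)
  moreover have "S \<inter> B \<noteq> {}" using S(2) xB by blast
  moreover have "S' \<inter> B \<noteq> {}" using S'(2) B(2) by blast
  ultimately have "S \<inter> S' \<inter> B \<noteq> {}" using lnk by blast
  then obtain p where p: "p \<in> S" "p \<in> S'" "p \<in> B" by blast
  \<comment> \<open>The common point lies at level \<open>d\<close> because
    \<open>B \<subseteq> Z\<close>. Membership in \<open>S\<close> puts it far from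
    \<open>b\<close>, membership in \<open>S'\<close> puts it near.\<close>
  have "p \<in> Z" using p(3) B(1) A(3) by blast
  then obtain w where w: "p = (w, Some d)" "w \<in> K d" by (auto simp: Z_def)
  have "w \<in> lev S" using down[OF S(1)] p(1) w(1) by simp
  then have "\<eta> l \<le> dist w b" using v(5) w(2) K[OF d(1)] by blast
  moreover have "(b, None) \<in> S'" using bS' by (simp add: lev_def)
  then have "dist w b < \<eta> l" using \<S>(4)[OF S'(1) p(2)] w(1) by fastforce
  ultimately show False by simp
qed

end

theorem theorem5p2:
  fixes D :: "'a set"
  assumes "cofinality {A :: real set. meager A} =o omega1"
    and "omega1 \<le>o |D|"
  shows "\<exists>X. closedin (prod_topology (top_of_set {0..1::real}) (one_point_discrete D)) X \<and>
    (let T = subtopology (prod_topology (top_of_set {0..1::real}) (one_point_discrete D)) X in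
       weight T =o omega1 \<and> first_countable T \<and> hereditarily_paracompact T \<and>
       \<not> supercompact_space T)"
proof -
  obtain D' and \<zeta> :: "'a \<Rightarrow> real" where sub: "D' \<subseteq> D" and card: "|D'| =o omega1"
    and \<zeta>': "\<forall>d\<in>D'. \<zeta> d \<in> {0<..<1}"
    and Luzin': "\<forall>M. meager M \<longrightarrow> countable {d \<in> D'. \<zeta> d \<in> M}"
    using Luzin_family_on[OF assms] by (elim exE conjE) (rule that)
  have \<zeta>: "\<zeta> d \<in> {0<..<1}" if "d \<in> D'" for d using \<zeta>' that by blast
  have Luzin: "countable {d \<in> D'. \<zeta> d \<in> M}" if "meager M" for M using Luzin' that by blast
  define K where "K d = coded (\<zeta> d)" for d
  interpret attached_sets D D' K
  proof
    show "K d \<subseteq> {0..1}" if "d \<in> D'" for d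
      using \<zeta>[OF that] unfolding K_def by (intro coded_subset) auto
  qed (simp_all add: K_def closed_coded sub)
  have "\<not> countable D'"
  proof
    assume "countable D'"
    then have "|D'| \<le>o natLeq" by (simp add: countable_iff_card_of)
    then have "omega1 \<le>o natLeq" using card by (meson ordIso_ordLeq_trans ordIso_symmetric)
    then show False using cardSuc_greater[OF natLeq_Card_order] not_ordLess_ordLeq by blast
  qed
  then have "\<not> supercompact_space T"
    using \<zeta> K_def Luzin by (intro not_supercompact_T)
  moreover have "weight T =o omega1"
    using card by (rule weight_T) (auto simp: K_def coded_def)
  moreover have "first_countable T"
  proof (rule first_countable_T)
    fix t
    have "countable {d \<in> D'. \<zeta> d \<in> {z. t \<in> coded z}}"
      by (intro Luzin countable_imp_meager countable_coded_fibre)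
    then show "countable {d \<in> D'. t \<in> K d}" by (simp add: K_def)
  qed
  moreover have "hereditarily_paracompact T"
  proof (rule hereditarily_paracompact_T)
    fix V :: "real set" assume V: "open V"
    \<comment> \<open>Compactness can fail only where \<open>\<zeta> d\<close> lies on the frontier
      of \<open>V\<close>, which is nowhere dense and so catches only countably many
      indices.\<close>
    have "{d \<in> D'. \<not> compact (K d \<inter> V)} \<subseteq> {d \<in> D'. \<zeta> d \<in> frontier V}"
    proof
      fix d assume d: "d \<in> {d \<in> D'. \<not> compact (K d \<inter> V)}"
      have "\<zeta> d \<in> {0..1}" using d \<zeta>[of d] by auto
      then show "d \<in> {d \<in> D'. \<zeta> d \<in> frontier V}" using d compact_coded_Int V by (auto simp: K_def)
    qed
    then show "countable {d \<in> D'. \<not> compact (K d \<inter> V)}"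
      using Luzin[OF meager_frontier[OF V]] by (rule countable_subset)
  qed
  ultimately show ?thesis
    using closedin_X unfolding Let_def by (intro exI[of _ X]) simp
qed

end
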